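(* Let $N\in\mathbb N_0$, $\alpha_1,\alpha_2,\beta>-1$, let $\omega_1,\omega_2$ be the Hahn weights, assumed to form an algebraic Chebyshev (AT) system, and let $(n_1,n_2),(m_1,m_2)\in\mathbb N_0^2$. Let $Q^{(1)}_{(n_1,n_2)},Q^{(2)}_{(n_1,n_2)}$ (type I) and $Q_{(m_1,m_2)}$ (type II) be the Hahn multiple orthogonal polynomials given by the explicit formulas in the context. Then $$\sum_{k=0}^N\Big(Q^{(1)}_{(n_1,n_2)}(k)\,\omega_1(k)+Q^{(2)}_{(n_1,n_2)}(k)\,\omega_2(k)\Big)Q_{(m_1,m_2)}(k)=\begin{cases}0,&\text{if } n_1\le m_1\text{ and } n_2\le m_2,\\ 1,&\text{if } m_1+m_2=n_1+n_2-1,\\ 0,&\text{if } m_1+m_2\le n_1+n_2-2.\end{cases}$$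
   Context: Pochhammer symbol: $(x)_n=\Gamma(x+n)/\Gamma(x)$, i.e. $(x)_0=1$, $(x)_n=x(x+1)\cdots(x+n-1)$. Hahn weights, for $a\in\{1,2\}$ and $x\in\{0,\dots,N\}$: $$\omega_a(x)=\frac{\Gamma(\alpha_a+x+1)}{\Gamma(\alpha_a+1)\Gamma(x+1)}\,\frac{\Gamma(\beta+N-x+1)}{\Gamma(\beta+1)\Gamma(N-x+1)}.$$ Notation: $\hat\alpha_1=\alpha_2$, $\hat\alpha_2=\alpha_1$, $\hat n_1=n_2$, $\hat n_2=n_1$. Type I Hahn polynomials, $a\in\{1,2\}$: $$Q^{(a)}_{(n_1,n_2)}(x)=\sum_{l=0}^{n_a-1}C^{(a),l}_{(n_1,n_2)}\,(-x)_l,$$ $$C^{(a),l}_{(n_1,n_2)}=K_a\,\frac{(\alpha_a+\beta+n_1+n_2)_l\,(\alpha_a-\hat\alpha_a-\hat n_a+1)_l}{l!\,(\alpha_a+1)_l\,(-N)_l}\sum_{m=0}^{n_a-1-l}\frac{(-n_a+1)_{l+m}\,(-N)_{l+m}\,(\hat\alpha_a-\alpha_a-n_a+1)_m}{m!\,(-n_1-n_2+2)_{l+m}\,(\hat\alpha_a+\beta+\hat n_a+1)_{l+m}},$$ $$K_a=\frac{(-1)^{n_a-1}(N+1-n_1-n_2)!\,(n_1+n_2-2)!}{(n_1-1)!\,(n_2-1)!\,(\beta+1)_{n_1+n_2-1}\,(\alpha_a+\beta+n_1+n_2+n_a)_{N+1-n_1-n_2}}\;\frac{(\hat\alpha_a+\beta+\hat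 n_a+1)_{n_1+n_2-1}}{(\alpha_a-\hat\alpha_a-\hat n_a+1)_{n_1+n_2-1}}.$$ Type II Hahn polynomials (monic): $$Q_{(m_1,m_2)}(x)=\frac{(\alpha_1+1)_{m_1}(\alpha_2+1)_{m_2}(-N)_{m_1+m_2}}{(\alpha_1+\beta+m_1+m_2+1)_{m_1}(\alpha_2+\beta+m_1+m_2+1)_{m_2}}\sum_{l=0}^{m_1+m_2}\frac{(\alpha_1+\beta+m_1+1)_l}{(\alpha_1+1)_l}\sum_{r=0}^{l}\frac{(-m_1)_r(-m_2)_{l-r}}{r!(l-r)!}\frac{(\alpha_2+\beta+m_1+m_2+1)_{l-r}(\alpha_1+m_1+1)_{l-r}}{(\alpha_2+1)_{l-r}(\alpha_1+\beta+m_1+1)_{l-r}}\frac{(-x)_l}{(-N)_l}.$$ They satisfy $\sum_{k=0}^NQ_{(m_1,m_2)}(k)\,\omega_a(k)\,(-k)_j=0$ for $j\in\{0,\dots,m_a-1\}$, $a\in\{1,2\}$ (Arvesú–Coussement–Van Assche).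
   Formalization: Assumes n_1+n_2 ≤ N+1, since K_a contains (N+1-n_1-n_2)!; when the other index is 0 the type I formula, undefined as printed, is replaced by its limit (classical Hahn polynomial); 0/0 quotients in the type II formula are read in cancelled form. *)

theory Defs
  imports "HOL-Analysis.Analysis" "HOL-Computational_Algebra.Polynomial"
begin

definition hahn_weight :: "nat \<Rightarrow> real \<Rightarrow> real \<Rightarrow> real \<Rightarrow> real" where
  "hahn_weight N \<alpha> \<beta> x =
     Gamma (\<alpha> + x + 1) / (Gamma (\<alpha> + 1) * Gamma (x + 1)) *
     (Gamma (\<beta> + real N - x + 1) / (Gamma (\<beta> + 1) * Gamma (real N - x + 1)))"

text \<open>
  Algebraic Chebyshev (AT) system for two discrete weights supported on \<open>{0..N}\<close>: the functions
  \<open>w\<^sub>1, x w\<^sub>1, \<dots>, x^(n\<^sub>1 - 1) w\<^sub>1, w\<^sub>2, x w\<^sub>2, \<dots>, x^(n\<^sub>2 - 1) w\<^sub>2\<close> form a Chebyshev system on the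
  support, i.e. every linear combination whose coefficients are not all zero has at most
  \<open>n\<^sub>1 + n\<^sub>2 - 1\<close> zeros there.  The support has \<open>N + 1\<close> points, so only \<open>n\<^sub>1 + n\<^sub>2 \<le> N + 1\<close>
  makes sense.  The linear combinations are written as \<open>p\<^sub>1 w\<^sub>1 + p\<^sub>2 w\<^sub>2\<close> with polynomials
  \<open>p\<^sub>a\<close> having fewer than \<open>n\<^sub>a\<close> coefficients (so \<open>p\<^sub>a = 0\<close> if \<open>n\<^sub>a = 0\<close>).
\<close>
definition AT_system :: "nat \<Rightarrow> (real \<Rightarrow> real) \<Rightarrow> (real \<Rightarrow> real) \<Rightarrow> bool" where
  "AT_system N w1 w2 \<longleftrightarrow>
     (\<forall>n1 n2. \<forall>p1 p2 :: real poly.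
        n1 + n2 \<le> N + 1 \<longrightarrow>
        (p1 = 0 \<or> degree p1 < n1) \<longrightarrow> (p2 = 0 \<or> degree p2 < n2) \<longrightarrow>
        \<not> (p1 = 0 \<and> p2 = 0) \<longrightarrow>
        card {k \<in> {0..N}. poly p1 (real k) * w1 (real k) + poly p2 (real k) * w2 (real k) = 0}
          < n1 + n2)"

text \<open>
  Type I polynomials.  The arguments \<open>\<alpha>\<close>, \<open>\<alpha>h\<close>, \<open>n\<close>, \<open>nh\<close> are \<open>\<alpha>\<^sub>a\<close>, \<open>\<alpha>\<^sub>b\<close>, \<open>n\<^sub>a\<close>, \<open>n\<^sub>b\<close> with \<open>b\<close>
  the index other than \<open>a\<close>.  The index must satisfy \<open>n + nh \<le> N + 1\<close>, because of the factorial
  of \<open>N + 1 - n - nh\<close>.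
\<close>
definition hahn_typeI_const :: "nat \<Rightarrow> real \<Rightarrow> real \<Rightarrow> real \<Rightarrow> nat \<Rightarrow> nat \<Rightarrow> real" where
  "hahn_typeI_const N \<beta> \<alpha> \<alpha>h n nh =
     (-1) ^ (n - 1) * fact (N + 1 - n - nh) * fact (n + nh - 2) /
       (fact (n - 1) * fact (nh - 1) * pochhammer (\<beta> + 1) (n + nh - 1) *
        pochhammer (\<alpha> + \<beta> + real (n + nh + n)) (N + 1 - n - nh)) *
     (pochhammer (\<alpha>h + \<beta> + real nh + 1) (n + nh - 1) /
       pochhammer (\<alpha> - \<alpha>h - real nh + 1) (n + nh - 1))"

text \<open>
  For \<open>nh = 0\<close> the explicit formula contains \<open>1 / (-1)!\<close> together with a vanishing
  \<open>(- n - nh + 2)\<^bsub>l+m\<^esub>\<close> in a denominator.  The value intended is the one obtained by cancelling: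
  for \<open>nh \<ge> 1\<close>, with \<open>j = l + m\<close>,
    \<open>(n + nh - 2)! / ((nh - 1)! (- n - nh + 2)\<^bsub>j\<^esub>) = (-1)^j (nh)\<^bsub>n-1-j\<^esub>\<close>,
    \<open>(\<alpha>h + \<beta> + nh + 1)\<^bsub>n+nh-1\<^esub> / (\<alpha>h + \<beta> + nh + 1)\<^bsub>j\<^esub> = (\<alpha>h + \<beta> + nh + 1 + j)\<^bsub>n+nh-1-j\<^esub>\<close>,
    \<open>(\<alpha> - \<alpha>h - nh + 1)\<^bsub>l\<^esub> (\<alpha>h - \<alpha> - n + 1)\<^bsub>m\<^esub> / (\<alpha> - \<alpha>h - nh + 1)\<^bsub>n+nh-1\<^esub>
       = (-1)^m / (\<alpha> - \<alpha>h - nh + 1 + l)\<^bsub>n+nh-1-j\<^esub>\<close>.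
  At \<open>nh = 0\<close> only \<open>j = n - 1\<close> survives, where these three quantities are \<open>(-1)^(n-1)\<close>, \<open>1\<close>
  and \<open>(-1)^m\<close>.  What remains is the classical Hahn polynomial of degree \<open>n - 1\<close>, with the
  coefficients in the first branch; it does not depend on \<open>\<alpha>h\<close>.
\<close>
definition hahn_typeI_coeff :: "nat \<Rightarrow> real \<Rightarrow> real \<Rightarrow> real \<Rightarrow> nat \<Rightarrow> nat \<Rightarrow> nat \<Rightarrow> real" where
  "hahn_typeI_coeff N \<beta> \<alpha> \<alpha>h n nh l =
     (if nh = 0 then
        (-1) ^ (n - 1) * fact N /
          (fact (n - 1) * pochhammer (\<beta> + 1) (n - 1) *
           pochhammer (\<alpha> + \<beta> + real (2 * n)) (N + 1 - n)) *
        (pochhammer (1 - real n) l * pochhammer (\<alpha> + \<beta> + real n) l /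
          (fact l * pochhammer (\<alpha> + 1) l * pochhammer (- real N) l))
      else
        hahn_typeI_const N \<beta> \<alpha> \<alpha>h n nh *
        (pochhammer (\<alpha> + \<beta> + real (n + nh)) l * pochhammer (\<alpha> - \<alpha>h - real nh + 1) l /
          (fact l * pochhammer (\<alpha> + 1) l * pochhammer (- real N) l)) *
        (\<Sum>m = 0..n - 1 - l.
           pochhammer (- real n + 1) (l + m) * pochhammer (- real N) (l + m) *
             pochhammer (\<alpha>h - \<alpha> - real n + 1) m /
           (fact m * pochhammer (- real n - real nh + 2) (l + m) *
             pochhammer (\<alpha>h + \<beta> + real nh + 1) (l + m))))"

definition hahn_typeI :: "nat \<Rightarrow> real \<Rightarrow> real \<Rightarrow> real \<Rightarrow> nat \<Rightarrow> nat \<Rightarrow> real \<Rightarrow> real" where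
  "hahn_typeI N \<beta> \<alpha> \<alpha>h n nh x =
     (\<Sum>l<n. hahn_typeI_coeff N \<beta> \<alpha> \<alpha>h n nh l * pochhammer (- x) l)"

text \<open>
  Type II polynomials.  In the explicit formula the quotients
    \<open>(-N)\<^bsub>m1+m2\<^esub> / (-N)\<^bsub>l\<^esub> = (l - N)\<^bsub>m1+m2-l\<^esub>\<close> and
    \<open>(\<alpha>1 + \<beta> + m1 + 1)\<^bsub>l\<^esub> / (\<alpha>1 + \<beta> + m1 + 1)\<^bsub>l-r\<^esub> = (\<alpha>1 + \<beta> + m1 + 1 + l - r)\<^bsub>r\<^esub>\<close>
  are written in cancelled form.  Otherwise they would be \<open>0 / 0\<close> if \<open>m1 + m2 > N\<close>, and
  if \<open>m1 = 0\<close>, \<open>\<alpha>1 + \<beta> = -1\<close>; see \<open>hahn_typeII_display\<close> below for the uncancelled formula.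
\<close>
definition hahn_typeII :: "nat \<Rightarrow> real \<Rightarrow> real \<Rightarrow> real \<Rightarrow> nat \<Rightarrow> nat \<Rightarrow> real \<Rightarrow> real" where
  "hahn_typeII N \<beta> \<alpha>1 \<alpha>2 m1 m2 x =
     pochhammer (\<alpha>1 + 1) m1 * pochhammer (\<alpha>2 + 1) m2 /
       (pochhammer (\<alpha>1 + \<beta> + real (m1 + m2) + 1) m1 *
        pochhammer (\<alpha>2 + \<beta> + real (m1 + m2) + 1) m2) *
     (\<Sum>l = 0..m1 + m2. 1 / pochhammer (\<alpha>1 + 1) l *
        (\<Sum>r = 0..l.
           pochhammer (- real m1) r * pochhammer (- real m2) (l - r) / (fact r * fact (l - r)) *
           pochhammer (\<alpha>1 + \<beta> + real m1 + 1 + real (l - r)) r *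
           (pochhammer (\<alpha>2 + \<beta> + real (m1 + m2) + 1) (l - r) *
              pochhammer (\<alpha>1 + real m1 + 1) (l - r) /
            pochhammer (\<alpha>2 + 1) (l - r))) *
        (pochhammer (real l - real N) (m1 + m2 - l) * pochhammer (- x) l))"

lemma hahn_typeII_display:
  assumes N: "m1 + m2 \<le> N"
    and nz: "\<And>l. l \<le> m1 + m2 \<Longrightarrow> pochhammer (\<alpha>1 + \<beta> + real m1 + 1) l \<noteq> 0"
  shows "hahn_typeII N \<beta> \<alpha>1 \<alpha>2 m1 m2 x =
     pochhammer (\<alpha>1 + 1) m1 * pochhammer (\<alpha>2 + 1) m2 * pochhammer (- real N) (m1 + m2) /
       (pochhammer (\<alpha>1 + \<beta> + real (m1 + m2) + 1) m1 *
        pochhammer (\<alpha>2 + \<beta> + real (m1 + m2) + 1) m2) *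
     (\<Sum>l = 0..m1 + m2. pochhammer (\<alpha>1 + \<beta> + real m1 + 1) l / pochhammer (\<alpha>1 + 1) l *
        (\<Sum>r = 0..l.
           pochhammer (- real m1) r * pochhammer (- real m2) (l - r) / (fact r * fact (l - r)) *
           (pochhammer (\<alpha>2 + \<beta> + real (m1 + m2) + 1) (l - r) *
              pochhammer (\<alpha>1 + real m1 + 1) (l - r) /
            (pochhammer (\<alpha>2 + 1) (l - r) * pochhammer (\<alpha>1 + \<beta> + real m1 + 1) (l - r)))) *
        (pochhammer (- x) l / pochhammer (- real N) l))"
proof -
  let ?c = "\<alpha>1 + \<beta> + real m1 + 1"
  have quotN: "pochhammer (real l - real N) (m1 + m2 - l)
      = pochhammer (- real N) (m1 + m2) / pochhammer (- real N) l" if "l \<le> m1 + m2" for l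
  proof -
    have "pochhammer (- real N) l \<noteq> 0"
      using N that by (simp add: pochhammer_of_nat_eq_0_iff)
    then show ?thesis
      using pochhammer_product[OF that, of "- real N"] by (simp add: field_simps)
  qed
  have quotc: "pochhammer (?c + real (l - r)) r = pochhammer ?c l / pochhammer ?c (l - r)"
    if "l \<le> m1 + m2" "r \<le> l" for l r
    using pochhammer_product[of "l - r" l ?c] nz[of "l - r"] that by (simp add: field_simps)
  show ?thesis
    unfolding hahn_typeII_def sum_distrib_left sum_distrib_right
    by (intro sum.cong refl) (simp add: quotN quotc mult_ac del: of_nat_diff)
qed

end

theory Submission
  imports Defs
begin

text \<open>
  Let \<open>g\<^sub>z\<close> be the Hahn weight with \<open>\<alpha>\<close> replaced by a free parameter \<open>z\<close>.  By Chu-Vandermonde the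
  sum of \<open>(-k)\<^sub>j g\<^sub>z(k)\<close> over \<open>k\<close> is a constant multiple of \<open>(z+1)\<^sub>j (z+\<beta>+2+j)\<^bsub>N-j\<^esub>\<close>.

  Summing the type II polynomial against \<open>g\<^sub>z\<close> therefore gives a polynomial in \<open>z\<close>, which two
  applications of the Pfaff-Saalschuetz formula identify as a multiple of
  \<open>(\<alpha>\<^sub>1-z)\<^bsub>m1\<^esub> (\<alpha>\<^sub>2-z)\<^bsub>m2\<^esub> (z+\<beta>+2+m\<^sub>1+m\<^sub>2)\<^bsub>N-m1-m2\<^esub>\<close>; its zeros \<open>\<alpha>\<^sub>a + i\<close>, \<open>i < m\<^sub>a\<close>, are the
  orthogonality relations.

  Dually, the type I linear form is a sum of residues of \<open>g\<^sub>z\<close> times a rational function of \<open>z\<close>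
  with simple poles at \<open>\<alpha>\<^sub>a + i\<close>, \<open>i < n\<^sub>a\<close>.  Its moments of order below \<open>n\<^sub>1+n\<^sub>2\<close> are then read off
  from the vanishing of the sum of all residues.  Expanding the residues in the basis \<open>(-x)\<^sub>l\<close> gives
  terminating hypergeometric sums, which a Thomae-type transformation turns into the
  explicit coefficients.  The AT hypothesis serves to keep the poles distinct.
\<close>

subsection \<open>Terminating hypergeometric sums and divided differences\<close>

text \<open>The factors of \<open>pochhammer (1 - a - n) n\<close> are the negatives of those of
  \<open>pochhammer a n\<close>, in reverse order.\<close>

lemma pochhammer_complement:
  fixes a :: "'a::comm_ring_1"
  shows "pochhammer (1 - a - of_nat n) n = (-1) ^ n * pochhammer a n"
  using pochhammer_minus[of "a + of_nat n - 1" n] by (simp add: algebra_simps)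

lemma pochhammer_complement_diff:
  fixes a :: "'a::comm_ring_1"
  assumes "k \<le> n"
  shows "pochhammer (1 - a - of_nat n) (n - k) = (-1) ^ (n - k) * pochhammer (a + of_nat k) (n - k)"
  using pochhammer_complement[of "a + of_nat k" "n - k"] assms by (simp add: of_nat_diff algebra_simps)

text \<open>Serves to reverse terminating sums: replacing \<open>k\<close> by \<open>n - k\<close>
  turns a Pochhammer factor into the reciprocal of a reflected one, up to a sign and a
  constant.\<close>

lemma pochhammer_complement_split:
  fixes a :: "'a::comm_ring_1"
  assumes "k \<le> n"
  shows "pochhammer a (n - k) * pochhammer (1 - a - of_nat n) k = (-1) ^ k * pochhammer a n"
proof -
  have "pochhammer (1 - a - of_nat n) k = (-1) ^ k * pochhammer (a + of_nat (n - k)) k"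
    using pochhammer_complement_diff[of "n - k" n a] assms by simp
  then show ?thesis
    using pochhammer_product[of "n - k" n a] assms by simp
qed

lemma pochhammer_minus_nat:
  assumes "k \<le> n"
  shows "pochhammer (- of_nat n :: 'a::field_char_0) k = (-1) ^ k * (fact n / fact (n - k))"
proof -
  have "fact n = fact (n - k) * pochhammer (1 + of_nat (n - k) :: 'a) k"
    using pochhammer_product[of "n - k" n "1::'a"] assms by (simp add: pochhammer_fact)
  moreover have "pochhammer (- of_nat n :: 'a) k = (-1) ^ k * pochhammer (1 + of_nat (n - k) :: 'a) k"
    using assms by (simp add: pochhammer_minus of_nat_diff algebra_simps)
  ultimately show ?thesis by simp
qed

lemma pochhammer_minus_binomial:
  "pochhammer (- of_nat n :: 'a::field_char_0) k / fact k = (-1) ^ k * of_nat (n choose k)"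
proof (cases "k \<le> n")
  case True
  then show ?thesis
    by (simp add: pochhammer_minus_nat binomial_fact)
qed (simp add: pochhammer_of_nat_eq_0_lemma binomial_eq_0)

lemma sum_swap_triangle:
  fixes f :: "nat \<Rightarrow> nat \<Rightarrow> 'a::comm_monoid_add"
  shows "(\<Sum>i\<le>n. \<Sum>j\<le>i. f i j) = (\<Sum>j\<le>n. \<Sum>i\<le>n - j. f (j + i) j)"
proof -
  have "(\<Sum>i\<le>n. \<Sum>j\<le>i. f i j) = (\<Sum>j\<le>n. \<Sum>i=j..n. f i j)"
    unfolding sum.Sigma[OF finite_atMost ballI[OF finite_atMost]]
      sum.Sigma[OF finite_atMost ballI[OF finite_atLeastAtMost]]
    by (rule sum.reindex_bij_witness[of _ "\<lambda>(j, i). (i, j)" "\<lambda>(i, j). (j, i)"]) auto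
  also have "\<dots> = (\<Sum>j\<le>n. \<Sum>i\<le>n - j. f (j + i) j)"
  proof (rule sum.cong[OF refl])
    fix j assume "j \<in> {..n}"
    then show "(\<Sum>i=j..n. f i j) = (\<Sum>i\<le>n - j. f (j + i) j)"
      by (intro sum.reindex_bij_witness[of _ "\<lambda>i. j + i" "\<lambda>i. i - j"]) auto
  qed
  finally show ?thesis .
qed

text \<open>This is 2F1(-n, a; b; 1) = (b-a)_n / (b)_n multiplied by (b)_n, hence free of division.
  It comes from the binomial theorem for rising factorials applied to a + (1 - b - n), with a
  reflection of the second factor and of the result.\<close>

lemma chu_vandermonde:
  fixes a b :: "'a::comm_ring_1"
  shows "(\<Sum>k\<le>n. (-1) ^ k * of_nat (n choose k) * pochhammer a k * pochhammer (b + of_nat k) (n - k))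
    = pochhammer (b - a) n"
proof -
  have "pochhammer (b - a) n = (-1) ^ n * pochhammer (1 - (b - a) - of_nat n) n"
    by (simp add: pochhammer_complement flip: mult.assoc power_add)
  also have "1 - (b - a) - of_nat n = a + (1 - b - of_nat n)" by simp
  also have "(-1) ^ n * pochhammer (a + (1 - b - of_nat n)) n =
      (\<Sum>k\<le>n. (-1) ^ n * (of_nat (n choose k) * pochhammer a k * pochhammer (1 - b - of_nat n) (n - k)))"
    by (simp add: pochhammer_binomial_sum sum_distrib_left)
  also have "\<dots> = (\<Sum>k\<le>n. (-1) ^ k * of_nat (n choose k) * pochhammer a k * pochhammer (b + of_nat k) (n - k))"
  proof (rule sum.cong[OF refl])
    fix k assume "k \<in> {..n}"
    then have k: "k \<le> n" by simp
    have "(-1) ^ n * (-1) ^ (n - k) = ((-1) ^ k :: 'a)"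
      using k by (simp flip: power_add add: minus_one_power_iff)
    then show "(-1) ^ n * (of_nat (n choose k) * pochhammer a k * pochhammer (1 - b - of_nat n) (n - k))
        = (-1) ^ k * of_nat (n choose k) * pochhammer a k * pochhammer (b + of_nat k) (n - k)"
      unfolding pochhammer_complement_diff[OF k] by (simp only: mult_ac) (simp only: mult.assoc[symmetric])
  qed
  finally show ?thesis by simp
qed

text \<open>Transforms the terminating sum (e)_p 3F2(-p, b, c; d, e; 1). The quotient (b)_i / (d)_i
  is expanded by Chu-Vandermonde in the quotients (d-b)_r / (d)_r; after the exchange of sums the
  sum over \<open>i\<close> is again of Chu-Vandermonde type.\<close>

lemma sheppard:
  fixes b c d e :: "'a::field_char_0"
  assumes "pochhammer d p \<noteq> 0"
  shows "(\<Sum>i\<le>p. (-1) ^ i * of_nat (p choose i) * pochhammer b i * pochhammer c i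
            * pochhammer (e + of_nat i) (p - i) / pochhammer d i)
       = (\<Sum>r\<le>p. of_nat (p choose r) * pochhammer (d - b) r * pochhammer c r
            * pochhammer (e - c) (p - r) / pochhammer d r)"
proof -
  have nz: "pochhammer d i \<noteq> 0" if "i \<le> p" for i
    using assms pochhammer_neq_0_mono that by blast
  define A where "A i = (-1) ^ i * of_nat (p choose i) * pochhammer c i * pochhammer (e + of_nat i) (p - i)" for i
  define B where "B r = (-1) ^ r * pochhammer (d - b) r / pochhammer d r" for r
  have ratio: "pochhammer b i / pochhammer d i = (\<Sum>r\<le>i. of_nat (i choose r) * B r)" if "i \<le> p" for i
  proof -
    have "pochhammer b i = (\<Sum>r\<le>i. (-1) ^ r * of_nat (i choose r) * pochhammer (d - b) r * pochhammer (d + of_nat r) (i - r))"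
      using chu_vandermonde[where n = i and a = "d - b" and b = d] by simp
    then have "pochhammer b i / pochhammer d i = (\<Sum>r\<le>i. (-1) ^ r * of_nat (i choose r)
        * pochhammer (d - b) r * pochhammer (d + of_nat r) (i - r) / pochhammer d i)"
      by (simp only: sum_divide_distrib)
    also have "\<dots> = (\<Sum>r\<le>i. of_nat (i choose r) * B r)"
    proof (rule sum.cong[OF refl])
      fix r assume "r \<in> {..i}"
      then have "pochhammer d i = pochhammer d r * pochhammer (d + of_nat r) (i - r)"
        by (simp add: pochhammer_product)
      moreover from this have "pochhammer (d + of_nat r) (i - r) \<noteq> 0"
        using nz[OF that] by auto
      ultimately show "(-1) ^ r * of_nat (i choose r) * pochhammer (d - b) r
          * pochhammer (d + of_nat r) (i - r) / pochhammer d i = of_nat (i choose r) * B r"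
        by (simp add: B_def)
    qed
    finally show ?thesis .
  qed
  have inner: "(\<Sum>i\<le>p - r. A (r + i) * of_nat ((r + i) choose r)) =
      (-1) ^ r * of_nat (p choose r) * pochhammer c r * pochhammer (e - c) (p - r)" if r: "r \<le> p" for r
  proof -
    have "(\<Sum>i\<le>p - r. A (r + i) * of_nat ((r + i) choose r)) =
      (\<Sum>i\<le>p - r. (-1) ^ r * of_nat (p choose r) * pochhammer c r * ((-1) ^ i * of_nat ((p - r) choose i)
          * pochhammer (c + of_nat r) i * pochhammer ((e + of_nat r) + of_nat i) (p - r - i)))"
    proof (rule sum.cong[OF refl])
      fix i assume i: "i \<in> {..p - r}"
      have "(p choose (r + i)) * ((r + i) choose r) = (p choose r) * ((p - r) choose i)"
        using choose_mult[of r "r + i" p] i r by simp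
      then have *: "of_nat (p choose (r + i)) * of_nat ((r + i) choose r) =
          (of_nat (p choose r) * of_nat ((p - r) choose i) :: 'a)"
        by (metis of_nat_mult)
      have "A (r + i) * of_nat ((r + i) choose r) = (-1) ^ (r + i)
          * (of_nat (p choose (r + i)) * of_nat ((r + i) choose r)) * pochhammer c (r + i)
          * pochhammer (e + of_nat (r + i)) (p - (r + i))"
        by (simp add: A_def mult_ac)
      then show "A (r + i) * of_nat ((r + i) choose r) =
          (-1) ^ r * of_nat (p choose r) * pochhammer c r * ((-1) ^ i * of_nat ((p - r) choose i)
          * pochhammer (c + of_nat r) i * pochhammer ((e + of_nat r) + of_nat i) (p - r - i))"
        unfolding * by (simp add: pochhammer_product' power_add add.assoc mult_ac)
    qed
    also have "\<dots> = (-1) ^ r * of_nat (p choose r) * pochhammer c r * pochhammer (e - c) (p - r)"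
      using chu_vandermonde[where n = "p - r" and a = "c + of_nat r" and b = "e + of_nat r"]
      by (simp flip: sum_distrib_left)
    finally show ?thesis .
  qed
  have "(\<Sum>i\<le>p. (-1) ^ i * of_nat (p choose i) * pochhammer b i * pochhammer c i
            * pochhammer (e + of_nat i) (p - i) / pochhammer d i) =
        (\<Sum>i\<le>p. A i * (pochhammer b i / pochhammer d i))"
    by (simp add: A_def mult_ac)
  also have "\<dots> = (\<Sum>i\<le>p. \<Sum>r\<le>i. A i * of_nat (i choose r) * B r)"
    by (auto simp: ratio sum_distrib_left mult_ac intro!: sum.cong)
  also have "\<dots> = (\<Sum>r\<le>p. (\<Sum>i\<le>p - r. A (r + i) * of_nat ((r + i) choose r)) * B r)"
    by (simp add: sum_swap_triangle sum_distrib_right)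
  also have "\<dots> = (\<Sum>r\<le>p. of_nat (p choose r) * pochhammer (d - b) r * pochhammer c r
            * pochhammer (e - c) (p - r) / pochhammer d r)"
  proof (rule sum.cong[OF refl])
    fix r assume "r \<in> {..p}"
    then have r: "r \<le> p" by simp
    let ?t = "of_nat (p choose r) * pochhammer (d - b) r * pochhammer c r
      * pochhammer (e - c) (p - r) / pochhammer d r"
    have "(\<Sum>i\<le>p - r. A (r + i) * of_nat ((r + i) choose r)) * B r = ((-1) ^ r * (-1) ^ r) * ?t"
      unfolding inner[OF r] B_def by simp
    then show "(\<Sum>i\<le>p - r. A (r + i) * of_nat ((r + i) choose r)) * B r = ?t"
      by (simp flip: power_mult_distrib)
  qed
  finally show ?thesis .
qed

text \<open>The balancing condition on \<open>d\<close> says d - b = 1 - (c - a) - n. After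
  Sheppard's transformation the factors (c-a)_r and (d-b)_(n-r) therefore combine, up to sign, to
  (c-a)_n, and Chu-Vandermonde sums the rest.\<close>

lemma pfaff_saalschuetz:
  fixes a b c :: "'a::field_char_0"
  assumes "pochhammer c n \<noteq> 0" and d: "d = 1 + a + b - c - of_nat n"
  shows "(\<Sum>i\<le>n. (-1) ^ i * of_nat (n choose i) * pochhammer a i * pochhammer b i
            * pochhammer (d + of_nat i) (n - i) / pochhammer c i)
       = (-1) ^ n * pochhammer (c - a) n * pochhammer (c - b) n / pochhammer c n"
proof -
  have nz: "pochhammer c i \<noteq> 0" if "i \<le> n" for i
    using assms pochhammer_neq_0_mono that by blast
  have "(\<Sum>i\<le>n. (-1) ^ i * of_nat (n choose i) * pochhammer a i * pochhammer b i
            * pochhammer (d + of_nat i) (n - i) / pochhammer c i)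
     = (\<Sum>r\<le>n. of_nat (n choose r) * pochhammer (c - a) r * pochhammer b r
            * pochhammer (d - b) (n - r) / pochhammer c r)"
    by (rule sheppard[OF assms(1)])
  also have "\<dots> = (\<Sum>r\<le>n. (-1) ^ n * pochhammer (c - a) n / pochhammer c n *
      ((-1) ^ r * of_nat (n choose r) * pochhammer b r * pochhammer (c + of_nat r) (n - r)))"
  proof (rule sum.cong[OF refl])
    fix r assume "r \<in> {..n}"
    then have r: "r \<le> n" by simp
    have sign: "(-1) ^ (n - r) = ((-1) ^ n * (-1) ^ r :: 'a)"
      using r by (simp flip: power_add add: minus_one_power_iff)
    have "d - b = 1 - (c - a) - of_nat n" by (simp add: d)
    then have "pochhammer (d - b) (n - r) = (-1) ^ n * (-1) ^ r * pochhammer (c - a + of_nat r) (n - r)"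
      by (simp only: pochhammer_complement_diff[OF r] sign)
    moreover have "pochhammer (c - a) n = pochhammer (c - a) r * pochhammer (c - a + of_nat r) (n - r)"
      "pochhammer c n = pochhammer c r * pochhammer (c + of_nat r) (n - r)"
      using r by (rule pochhammer_product)+
    ultimately show "of_nat (n choose r) * pochhammer (c - a) r * pochhammer b r
            * pochhammer (d - b) (n - r) / pochhammer c r = (-1) ^ n * pochhammer (c - a) n / pochhammer c n *
      ((-1) ^ r * of_nat (n choose r) * pochhammer b r * pochhammer (c + of_nat r) (n - r))"
      using nz[OF r] assms(1) by (simp add: field_simps)
  qed
  also have "\<dots> = (-1) ^ n * pochhammer (c - a) n * pochhammer (c - b) n / pochhammer c n"
    by (simp only: chu_vandermonde sum_distrib_left[symmetric]) simp
  finally show ?thesis .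
qed

text \<open>
  Both sides become the same sum when Sheppard's transformation is applied to each of them and
  one of the results is summed backwards.
\<close>
lemma thomae_terminating:
  fixes b c d e :: "'a::field_char_0"
  assumes "pochhammer d p \<noteq> 0" "pochhammer e p \<noteq> 0" "pochhammer (e - b) p \<noteq> 0"
  shows "pochhammer e p * (\<Sum>i\<le>p. (-1) ^ i * of_nat (p choose i) * pochhammer b i * pochhammer c i
            * pochhammer (d + of_nat i) (p - i) / pochhammer e i)
       = pochhammer (e - b) p * (\<Sum>i\<le>p. (-1) ^ i * of_nat (p choose i)
            * pochhammer (1 - (d + e - b - c + of_nat p)) i * pochhammer (1 - e - of_nat p) i
            * pochhammer (1 + c - e - of_nat p + of_nat i) (p - i) / pochhammer (1 + b - e - of_nat p) i)"
proof -
  let ?d = "1 + b - e - of_nat p"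
  have dneq: "pochhammer ?d p \<noteq> 0"
    using pochhammer_complement[of "e - b" p] assms by (simp add: algebra_simps)
  have nz: "pochhammer e i \<noteq> 0" "pochhammer ?d i \<noteq> 0" if "i \<le> p" for i
    using assms dneq pochhammer_neq_0_mono that by blast+
  have "pochhammer e p * (\<Sum>i\<le>p. (-1) ^ i * of_nat (p choose i) * pochhammer b i * pochhammer c i
            * pochhammer (d + of_nat i) (p - i) / pochhammer e i)
     = pochhammer e p * (\<Sum>r\<le>p. of_nat (p choose r) * pochhammer (e - b) r * pochhammer c r
            * pochhammer (d - c) (p - r) / pochhammer e r)"
    by (simp only: sheppard[OF assms(2)])
  also have "(\<Sum>r\<le>p. of_nat (p choose r) * pochhammer (e - b) r * pochhammer c r
            * pochhammer (d - c) (p - r) / pochhammer e r)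
      = (\<Sum>r\<le>p. of_nat (p choose r) * pochhammer (e - b) (p - r) * pochhammer c (p - r)
            * pochhammer (d - c) r / pochhammer e (p - r))"
    by (rule sum.reindex_bij_witness[of _ "\<lambda>r. p - r" "\<lambda>r. p - r"]) (auto simp: binomial_symmetric[symmetric])
  also have "pochhammer e p * \<dots> = pochhammer (e - b) p * (\<Sum>r\<le>p. of_nat (p choose r)
      * pochhammer (d - c) r * pochhammer (1 - e - of_nat p) r * pochhammer c (p - r) / pochhammer ?d r)"
    unfolding sum_distrib_left
  proof (rule sum.cong[OF refl])
    fix r assume "r \<in> {..p}"
    then have r: "r \<le> p" by simp
    have "pochhammer e (p - r) * pochhammer (1 - e - of_nat p) r = (-1) ^ r * pochhammer e p"
      by (rule pochhammer_complement_split[OF r])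
    then have E: "pochhammer e p / pochhammer e (p - r) = (-1) ^ r * pochhammer (1 - e - of_nat p) r"
      using nz(1)[of "p - r"] by (simp add: field_simps flip: power_mult_distrib)
    have D: "pochhammer (e - b) (p - r) * pochhammer ?d r = (-1) ^ r * pochhammer (e - b) p"
      using pochhammer_complement_split[OF r, of "e - b"] by (simp add: algebra_simps)
    then have D: "pochhammer (e - b) (p - r) = (-1) ^ r * pochhammer (e - b) p / pochhammer ?d r"
      using nz(2)[OF r] by (simp add: field_simps)
    have "pochhammer e p * (of_nat (p choose r) * pochhammer (e - b) (p - r) * pochhammer c (p - r)
            * pochhammer (d - c) r / pochhammer e (p - r))
        = (pochhammer e p / pochhammer e (p - r)) * pochhammer (e - b) (p - r) * (of_nat (p choose r)
            * pochhammer c (p - r) * pochhammer (d - c) r)"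
      by simp
    also have "\<dots> = ((-1) ^ r * (-1) ^ r) * pochhammer (e - b) p * (of_nat (p choose r)
      * pochhammer (d - c) r * pochhammer (1 - e - of_nat p) r * pochhammer c (p - r) / pochhammer ?d r)"
      unfolding E D by simp
    finally show "pochhammer e p * (of_nat (p choose r) * pochhammer (e - b) (p - r) * pochhammer c (p - r)
            * pochhammer (d - c) r / pochhammer e (p - r)) = pochhammer (e - b) p * (of_nat (p choose r)
      * pochhammer (d - c) r * pochhammer (1 - e - of_nat p) r * pochhammer c (p - r) / pochhammer ?d r)"
      by (simp flip: power_mult_distrib)
  qed
  \<comment> \<open>For these parameters the two differences occurring in Sheppard's transformation
    are \<open>d - c\<close> and \<open>c\<close>.\<close>
  also have "(\<Sum>r\<le>p. of_nat (p choose r)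
      * pochhammer (d - c) r * pochhammer (1 - e - of_nat p) r * pochhammer c (p - r) / pochhammer ?d r)
     = (\<Sum>i\<le>p. (-1) ^ i * of_nat (p choose i)
            * pochhammer (1 - (d + e - b - c + of_nat p)) i * pochhammer (1 - e - of_nat p) i
            * pochhammer (1 + c - e - of_nat p + of_nat i) (p - i) / pochhammer ?d i)"
    using sheppard[OF dneq, of "1 - (d + e - b - c + of_nat p)" "1 - e - of_nat p" "1 + c - e - of_nat p"]
    by (simp add: algebra_simps)
  finally show ?thesis .
qed

section \<open>Divided differences of polynomials of low degree\<close>

text \<open>The sum is the coefficient of degree \<open>card X - 1\<close> in the Lagrange
  interpolant of \<open>p\<close> on \<open>X\<close>. That interpolant is \<open>p\<close> itself,
  whose degree is smaller than \<open>card X - 1\<close>.\<close>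

lemma divided_difference_eq_0:
  fixes p :: "'a::field poly"
  assumes "finite X" and "degree p + 1 < card X"
  shows "(\<Sum>x\<in>X. poly p x / (\<Prod>y\<in>X - {x}. x - y)) = 0"
proof -
  define L where "L x = smult (poly p x / (\<Prod>y\<in>X - {x}. x - y)) (\<Prod>y\<in>X - {x}. [:- y, 1:])" for x
  define q where "q = (\<Sum>x\<in>X. L x)"
  have degprod: "degree (\<Prod>y\<in>X - {x}. [:- y, 1:]) = card X - 1" if "x \<in> X" for x
    using that assms(1) by (simp add: degree_prod_eq_sum_degree)
  have coeff: "coeff (L x) (card X - 1) = poly p x / (\<Prod>y\<in>X - {x}. x - y)" if "x \<in> X" for x
  proof -
    have "lead_coeff (\<Prod>y\<in>X - {x}. [:- y, 1:]) = 1"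
      by (simp add: lead_coeff_prod)
    then show ?thesis using degprod[OF that] by (simp add: L_def)
  qed
  have "degree q \<le> card X - 1"
    unfolding q_def by (rule degree_sum_le[OF assms(1)])
      (use degprod in \<open>auto simp: L_def intro: order_trans[OF degree_smult_le]\<close>)
  moreover have "poly q z = poly p z" if z: "z \<in> X" for z
  proof -
    have "poly (L x) z = (if x = z then poly p z else 0)" if "x \<in> X" for x
    proof (cases "x = z")
      case True
      have "(\<Prod>y\<in>X - {z}. z - y) \<noteq> 0"
        using assms(1) by simp
      with True show ?thesis by (simp add: L_def poly_prod)
    next
      case False
      then have "(\<Prod>y\<in>X - {x}. z - y) = 0" using assms(1) z by auto
      with False show ?thesis by (simp add: L_def poly_prod)
    qed
    then show ?thesis
      using z assms(1) by (simp add: q_def poly_sum sum.delta')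
  qed
  ultimately have "q = p"
    using assms(2) by (intro poly_eqI_degree[of X]) auto
  then have "coeff q (card X - 1) = 0"
    using assms(2) by (simp add: coeff_eq_0)
  moreover have "coeff q (card X - 1) = (\<Sum>x\<in>X. poly p x / (\<Prod>y\<in>X - {x}. x - y))"
    unfolding q_def coeff_sum by (rule sum.cong) (simp_all only: coeff)
  ultimately show ?thesis by simp
qed

subsection \<open>Type II polynomials\<close>

text \<open>
  The Hahn weight with the parameter \<open>\<alpha>\<close> replaced by an arbitrary \<open>z\<close>.  Multiplying the weight
  \<open>\<omega>\<close> of parameter \<open>\<alpha>\<close> by \<open>(\<alpha> + 1 + x)\<^sub>i\<close> amounts to shifting \<open>z = \<alpha>\<close> to \<open>\<alpha> + i\<close>,
  so orthogonality against \<open>\<omega>\<close> becomes vanishing at the points \<open>\<alpha> + i\<close>.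
\<close>
definition hahn_kernel :: "nat \<Rightarrow> real \<Rightarrow> real \<Rightarrow> nat \<Rightarrow> real" where
  "hahn_kernel N \<beta> z k =
     pochhammer (z + 1) k / fact k * (pochhammer (\<beta> + 1) (N - k) / fact (N - k))"

lemma hahn_weight_eq_kernel:
  assumes "\<alpha> > -1" "\<beta> > -1" "k \<le> N"
  shows "hahn_weight N \<alpha> \<beta> (real k) = hahn_kernel N \<beta> \<alpha> k"
proof -
  have G: "pochhammer (c + 1) n = Gamma (c + real n + 1) / Gamma (c + 1)" if "c > -1" for c :: real and n
  proof -
    have "c + 1 \<notin> \<int>\<^sub>\<le>\<^sub>0"
      using that by (auto elim!: nonpos_Ints_cases)
    then show ?thesis
      using pochhammer_Gamma[of "c + 1" n] by (simp add: add_ac)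
  qed
  have F: "Gamma (real n + 1) = fact n" for n
    using Gamma_fact[of n, where 'a = real] by (simp add: add_ac)
  have "real N - real k = real (N - k)" using assms by simp
  then have e: "\<beta> + real N - real k + 1 = \<beta> + real (N - k) + 1" "real N - real k + 1 = real (N - k) + 1"
    by linarith+
  show ?thesis
    unfolding hahn_weight_def hahn_kernel_def e F G[OF assms(1)] G[OF assms(2)]
    by (simp only: divide_divide_eq_left)
qed

lemma hahn_kernel_shift:
  assumes "pochhammer (z + 1) i \<noteq> 0"
  shows "hahn_kernel N \<beta> (z + real i) k
    = hahn_kernel N \<beta> z k * pochhammer (z + 1 + real k) i / pochhammer (z + 1) i"
proof -
  have "pochhammer (z + 1) i * pochhammer (z + real i + 1) k
      = pochhammer (z + 1) k * pochhammer (z + 1 + real k) i"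
    using pochhammer_product'[of "z + 1" i k] pochhammer_product'[of "z + 1" k i]
    by (simp add: add_ac)
  then have "pochhammer (z + real i + 1) k = pochhammer (z + 1) k * pochhammer (z + 1 + real k) i / pochhammer (z + 1) i"
    using assms by (simp add: field_simps)
  then show ?thesis by (simp add: hahn_kernel_def mult_ac)
qed

text \<open>The factor (-k)_j kills the terms with k < j and, for k = j + i, reduces
  \<open>fact k\<close> to \<open>fact i\<close>. What remains is the binomial convolution of
  (z+1+j)_i with (\<beta>+1)_(N-j-i).\<close>

lemma hahn_kernel_moment:
  assumes "j \<le> N"
  shows "(\<Sum>k\<le>N. pochhammer (- real k) j * hahn_kernel N \<beta> z k)
    = (-1) ^ j * pochhammer (z + 1) j * pochhammer (z + \<beta> + 2 + real j) (N - j) / fact (N - j)"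
proof -
  let ?g = "\<lambda>i. of_nat ((N - j) choose i) * pochhammer (z + 1 + real j) i * pochhammer (\<beta> + 1) (N - j - i)"
  have "(\<Sum>k\<le>N. pochhammer (- real k) j * hahn_kernel N \<beta> z k)
      = (\<Sum>k\<in>{j..N}. pochhammer (- real k) j * hahn_kernel N \<beta> z k)"
    by (rule sum.mono_neutral_right) (auto simp: pochhammer_of_nat_eq_0_lemma)
  also have "\<dots> = (\<Sum>i\<le>N - j. pochhammer (- real (j + i)) j * hahn_kernel N \<beta> z (j + i))"
    using assms by (intro sum.reindex_bij_witness[of _ "\<lambda>i. j + i" "\<lambda>i. i - j"]) auto
  also have "\<dots> = (\<Sum>i\<le>N - j. (-1) ^ j * pochhammer (z + 1) j / fact (N - j) * ?g i)"
  proof (rule sum.cong[OF refl])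
    fix i assume "i \<in> {..N - j}"
    then have i: "i \<le> N - j" by simp
    have p: "pochhammer (- real (j + i)) j = (-1) ^ j * (fact (j + i) / fact i)"
      using pochhammer_minus_nat[of j "j + i", where 'a = real] by simp
    have b: "real ((N - j) choose i) = fact (N - j) / (fact i * fact (N - j - i))"
      using i by (rule binomial_fact)
    have d: "N - (j + i) = N - j - i" by simp
    show "pochhammer (- real (j + i)) j * hahn_kernel N \<beta> z (j + i)
        = (-1) ^ j * pochhammer (z + 1) j / fact (N - j) * ?g i"
      unfolding hahn_kernel_def p b d pochhammer_product'[of "z + 1" j i] by simp
  qed
  also have "\<dots> = (-1) ^ j * pochhammer (z + 1) j / fact (N - j)
      * pochhammer (z + 1 + real j + (\<beta> + 1)) (N - j)"
    by (simp only: sum_distrib_left[symmetric] pochhammer_binomial_sum)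
  finally show ?thesis by (simp add: add_ac)
qed

text \<open>Chu-Vandermonde writes (-k)_l as a combination of the (\<alpha>+1+k)_u with u \<le> l.
  The kernel at \<alpha> absorbs each of these by moving its parameter to \<alpha> + u, where
  \<open>ortho\<close> applies.\<close>

lemma sum_kernel_pochhammer_eq_0:
  assumes "\<alpha> > -1" "l < m"
    and ortho: "\<And>u. u < m \<Longrightarrow> (\<Sum>k\<le>N. f k * hahn_kernel N \<beta> (\<alpha> + real u) k) = 0"
  shows "(\<Sum>k\<le>N. f k * hahn_kernel N \<beta> \<alpha> k * pochhammer (- real k) l) = 0"
proof -
  have pos: "pochhammer (\<alpha> + 1) u > 0" for u
    using assms(1) by (intro pochhammer_pos) simp
  let ?c = "\<lambda>u. (-1) ^ u * real (l choose u) * pochhammer (\<alpha> + 1 + real u) (l - u) * pochhammer (\<alpha> + 1) u"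
  have "f k * hahn_kernel N \<beta> \<alpha> k * pochhammer (- real k) l
      = (\<Sum>u\<le>l. ?c u * (f k * hahn_kernel N \<beta> (\<alpha> + real u) k))" for k
  proof -
    have "pochhammer (- real k) l = (\<Sum>u\<le>l. (-1) ^ u * real (l choose u)
        * pochhammer (\<alpha> + 1 + real k) u * pochhammer (\<alpha> + 1 + real u) (l - u))"
      using chu_vandermonde[of l "\<alpha> + 1 + real k" "\<alpha> + 1"] by simp
    moreover have "hahn_kernel N \<beta> \<alpha> k * pochhammer (\<alpha> + 1 + real k) u
        = pochhammer (\<alpha> + 1) u * hahn_kernel N \<beta> (\<alpha> + real u) k" for u
      using pos[of u] by (simp add: hahn_kernel_shift)
    then have "f k * hahn_kernel N \<beta> \<alpha> k * (c * pochhammer (\<alpha> + 1 + real k) u * d)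
       = c * d * pochhammer (\<alpha> + 1) u * (f k * hahn_kernel N \<beta> (\<alpha> + real u) k)" for u c d
      by (metis (no_types, opaque_lifting) mult.assoc mult.commute)
    ultimately show ?thesis by (simp only: sum_distrib_left)
  qed
  then have "(\<Sum>k\<le>N. f k * hahn_kernel N \<beta> \<alpha> k * pochhammer (- real k) l)
      = (\<Sum>u\<le>l. ?c u * (\<Sum>k\<le>N. f k * hahn_kernel N \<beta> (\<alpha> + real u) k))"
    by (simp only: sum_distrib_left) (rule sum.swap)
  also have "\<dots> = 0"
    using assms(2) by (intro sum.neutral) (auto simp: ortho)
  finally show ?thesis .
qed

text \<open>
  With \<open>q = l - r\<close>, the sum over \<open>r\<close> and then the sum over \<open>q\<close> are both balanced, so the
  Pfaff-Saalschuetz formula applies twice.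
\<close>
lemma hahn_typeII_double_sum:
  fixes \<alpha>1 \<alpha>2 \<beta> z :: real
  assumes "\<alpha>1 > -1" "\<alpha>2 > -1"
  shows "(\<Sum>l\<le>m1 + m2. \<Sum>r\<le>l. pochhammer (z + 1) l * pochhammer (z + \<beta> + 2 + real l) (m1 + m2 - l)
            / pochhammer (\<alpha>1 + 1) l *
           (pochhammer (- real m1) r * pochhammer (- real m2) (l - r) / (fact r * fact (l - r)) *
           pochhammer (\<alpha>1 + \<beta> + real m1 + 1 + real (l - r)) r *
           (pochhammer (\<alpha>2 + \<beta> + real (m1 + m2) + 1) (l - r) *
              pochhammer (\<alpha>1 + real m1 + 1) (l - r) /
            pochhammer (\<alpha>2 + 1) (l - r))))
       = pochhammer (\<beta> + 1) (m1 + m2) * pochhammer (\<alpha>1 - z) m1 * pochhammer (\<alpha>2 - z) m2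
           / (pochhammer (\<alpha>1 + 1) m1 * pochhammer (\<alpha>2 + 1) m2)"
proof -
  define M where "M = m1 + m2"
  have pos1: "pochhammer (\<alpha>1 + 1 + real q) u > 0" for u q
    using assms(1) by (intro pochhammer_pos) simp
  have pos2: "pochhammer (\<alpha>2 + 1) u > 0" for u
    using assms(2) by (intro pochhammer_pos) simp
  define f where "f r q = pochhammer (z + 1) (r + q) * pochhammer (z + \<beta> + 2 + real (r + q)) (M - (r + q))
            / pochhammer (\<alpha>1 + 1) (r + q) *
           (pochhammer (- real m1) r * pochhammer (- real m2) q / (fact r * fact q) *
           pochhammer (\<alpha>1 + \<beta> + real m1 + 1 + real q) r *
           (pochhammer (\<alpha>2 + \<beta> + real M + 1) q * pochhammer (\<alpha>1 + real m1 + 1) q / pochhammer (\<alpha>2 + 1) q))"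
    for r q
  define g where "g q r = (-1) ^ r * real (m1 choose r) * pochhammer (\<alpha>1 + \<beta> + real m1 + 1 + real q) r
      * pochhammer (z + 1 + real q) r * pochhammer (z + \<beta> + 2 + real q + real r) (m1 - r)
      / pochhammer (\<alpha>1 + 1 + real q) r" for q r
  define h where "h q = (-1) ^ q * real (m2 choose q) * pochhammer (\<alpha>2 + \<beta> + real M + 1) q
      * pochhammer (z + 1) q * pochhammer (z + \<beta> + 2 + real m1 + real q) (m2 - q) / pochhammer (\<alpha>2 + 1) q" for q
  have f_eq: "f r q = h q * (pochhammer (\<alpha>1 + real m1 + 1) q / pochhammer (\<alpha>1 + 1) q) * g q r"
    if r: "r \<le> m1" and q: "q \<le> m2" for r q
  proof -
    have a: "pochhammer (z + 1) (r + q) = pochhammer (z + 1) q * pochhammer (z + 1 + real q) r" for z :: real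
      using pochhammer_product'[of "z + 1" q r] by (simp add: add_ac)
    have "M - (r + q) = (m1 - r) + (m2 - q)"
      using r q by (auto simp: M_def)
    moreover have "z + \<beta> + 2 + real (r + q) = z + \<beta> + 2 + real q + real r"
      "z + \<beta> + 2 + real q + real r + real (m1 - r) = z + \<beta> + 2 + real m1 + real q"
      using r by simp_all
    ultimately have b: "pochhammer (z + \<beta> + 2 + real (r + q)) (M - (r + q))
        = pochhammer (z + \<beta> + 2 + real q + real r) (m1 - r) * pochhammer (z + \<beta> + 2 + real m1 + real q) (m2 - q)"
      by (simp only: pochhammer_product')
    have c: "pochhammer (- real m1) r * pochhammer (- real m2) q / (fact r * fact q)
        = ((-1) ^ r * real (m1 choose r)) * ((-1) ^ q * real (m2 choose q))"
      using pochhammer_minus_binomial[of m1 r, where 'a = real] pochhammer_minus_binomial[of m2 q, where 'a = real]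
      by (metis times_divide_times_eq)
    show ?thesis
      unfolding f_def g_def h_def a b c by (simp add: mult_ac)
  qed
  have inner: "(\<Sum>r\<le>m1. g q r) = pochhammer (\<beta> + 1) m1 * pochhammer (\<alpha>1 - z) m1 / pochhammer (\<alpha>1 + 1 + real q) m1" for q
  proof -
    have "(\<Sum>r\<le>m1. g q r) = (-1) ^ m1 * pochhammer (\<alpha>1 + 1 + real q - (\<alpha>1 + \<beta> + real m1 + 1 + real q)) m1
        * pochhammer (\<alpha>1 + 1 + real q - (z + 1 + real q)) m1 / pochhammer (\<alpha>1 + 1 + real q) m1"
      unfolding g_def using pos1[of q m1] by (intro pfaff_saalschuetz) simp_all
    also have "\<alpha>1 + 1 + real q - (\<alpha>1 + \<beta> + real m1 + 1 + real q) = 1 - (\<beta> + 1) - real m1" by simp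
    also have "(-1) ^ m1 * pochhammer \<dots> m1 = pochhammer (\<beta> + 1) m1"
      by (simp only: pochhammer_complement) (simp flip: mult.assoc power_mult_distrib)
    finally show ?thesis by simp
  qed
  have outer: "(\<Sum>q\<le>m2. h q) = pochhammer (\<beta> + 1 + real m1) m2 * pochhammer (\<alpha>2 - z) m2 / pochhammer (\<alpha>2 + 1) m2"
  proof -
    have "(\<Sum>q\<le>m2. h q) = (-1) ^ m2 * pochhammer (\<alpha>2 + 1 - (\<alpha>2 + \<beta> + real M + 1)) m2
        * pochhammer (\<alpha>2 + 1 - (z + 1)) m2 / pochhammer (\<alpha>2 + 1) m2"
      unfolding h_def using pos2[of m2] by (intro pfaff_saalschuetz) (simp_all add: M_def)
    also have "\<alpha>2 + 1 - (\<alpha>2 + \<beta> + real M + 1) = 1 - (\<beta> + 1 + real m1) - real m2" by (simp add: M_def)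
    also have "(-1) ^ m2 * pochhammer \<dots> m2 = pochhammer (\<beta> + 1 + real m1) m2"
      by (simp only: pochhammer_complement) (simp flip: mult.assoc power_mult_distrib)
    finally show ?thesis by simp
  qed
  \<comment> \<open>The denominator (\<alpha>1+1+q)_m1 of the inner sum absorbs the quotient in
    front of it. The dependence on \<open>q\<close> is left in \<open>h q\<close> alone, so the two
    sums separate.\<close>
  have mid: "h q * (pochhammer (\<alpha>1 + real m1 + 1) q / pochhammer (\<alpha>1 + 1) q) * (\<Sum>r\<le>m1. g q r)
      = h q * (pochhammer (\<beta> + 1) m1 * pochhammer (\<alpha>1 - z) m1 / pochhammer (\<alpha>1 + 1) m1)" for q
  proof -
    have "pochhammer (\<alpha>1 + 1) q * pochhammer (\<alpha>1 + 1 + real q) m1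
        = pochhammer (\<alpha>1 + 1) m1 * pochhammer (\<alpha>1 + real m1 + 1) q"
      using pochhammer_product'[of "\<alpha>1 + 1" q m1] pochhammer_product'[of "\<alpha>1 + 1" m1 q] by (simp add: add_ac)
    then have "pochhammer (\<alpha>1 + real m1 + 1) q / (pochhammer (\<alpha>1 + 1) q * pochhammer (\<alpha>1 + 1 + real q) m1)
        = 1 / pochhammer (\<alpha>1 + 1) m1"
      using pos1[of 0 q] pos1[of 0 m1] pos1[of q m1] pos1[of m1 q]
      by (simp add: frac_eq_eq add_ac mult_ac less_imp_neq[symmetric])
    moreover have "h q * (pochhammer (\<alpha>1 + real m1 + 1) q / pochhammer (\<alpha>1 + 1) q) * (\<Sum>r\<le>m1. g q r)
        = h q * (pochhammer (\<beta> + 1) m1 * pochhammer (\<alpha>1 - z) m1)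
          * (pochhammer (\<alpha>1 + real m1 + 1) q / (pochhammer (\<alpha>1 + 1) q * pochhammer (\<alpha>1 + 1 + real q) m1))"
      unfolding inner by (simp add: mult_ac)
    ultimately show ?thesis by simp
  qed
  have "(\<Sum>l\<le>M. \<Sum>r\<le>l. f r (l - r)) = (\<Sum>(r, q)\<in>{(r, q). r + q \<le> M}. f r q)"
    by (rule sum.triangle_reindex_eq[symmetric])
  \<comment> \<open>The rectangle lies in the triangle since \<open>M = m1 + m2\<close>, and outside
    it one of the factors (-m1)_r, (-m2)_q vanishes.\<close>
  also have "\<dots> = (\<Sum>(r, q)\<in>{..m1} \<times> {..m2}. f r q)"
  proof (rule sum.mono_neutral_right)
    have "{(r, q). r + q \<le> M} \<subseteq> {..M} \<times> {..M}" by auto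
    then show "finite {(r, q). r + q \<le> M}" by (rule finite_subset) simp
  qed (auto simp: M_def f_def pochhammer_of_nat_eq_0_iff)
  also have "\<dots> = (\<Sum>q\<le>m2. \<Sum>r\<le>m1. f r q)"
    by (subst sum.swap) (simp add: sum.cartesian_product)
  also have "\<dots> = (\<Sum>q\<le>m2. h q * (pochhammer (\<alpha>1 + real m1 + 1) q / pochhammer (\<alpha>1 + 1) q) * (\<Sum>r\<le>m1. g q r))"
    by (intro sum.cong refl) (simp add: f_eq sum_distrib_left)
  also have "\<dots> = (\<Sum>q\<le>m2. h q) * (pochhammer (\<beta> + 1) m1 * pochhammer (\<alpha>1 - z) m1 / pochhammer (\<alpha>1 + 1) m1)"
    unfolding mid by (rule sum_distrib_right[symmetric])
  also have "\<dots> = pochhammer (\<beta> + 1) (m1 + m2) * pochhammer (\<alpha>1 - z) m1 * pochhammer (\<alpha>2 - z) m2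
           / (pochhammer (\<alpha>1 + 1) m1 * pochhammer (\<alpha>2 + 1) m2)"
    unfolding outer pochhammer_product' by (simp add: mult_ac)
  finally show ?thesis
  proof -
    assume *: "(\<Sum>l\<le>M. \<Sum>r\<le>l. f r (l - r)) = pochhammer (\<beta> + 1) (m1 + m2) * pochhammer (\<alpha>1 - z) m1 * pochhammer (\<alpha>2 - z) m2
           / (pochhammer (\<alpha>1 + 1) m1 * pochhammer (\<alpha>2 + 1) m2)"
    show ?thesis
      unfolding *[symmetric]
      by (intro sum.cong) (simp_all only: f_def M_def le_add_diff_inverse atMost_iff)
  qed
qed

definition hahn_typeII_coeff :: "nat \<Rightarrow> real \<Rightarrow> real \<Rightarrow> real \<Rightarrow> nat \<Rightarrow> nat \<Rightarrow> nat \<Rightarrow> real" where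
  "hahn_typeII_coeff N \<beta> \<alpha>1 \<alpha>2 m1 m2 l =
     pochhammer (\<alpha>1 + 1) m1 * pochhammer (\<alpha>2 + 1) m2 /
       (pochhammer (\<alpha>1 + \<beta> + real (m1 + m2) + 1) m1 *
        pochhammer (\<alpha>2 + \<beta> + real (m1 + m2) + 1) m2) *
     (\<Sum>r\<le>l. pochhammer (- real m1) r * pochhammer (- real m2) (l - r) / (fact r * fact (l - r)) *
           pochhammer (\<alpha>1 + \<beta> + real m1 + 1 + real (l - r)) r *
           (pochhammer (\<alpha>2 + \<beta> + real (m1 + m2) + 1) (l - r) *
              pochhammer (\<alpha>1 + real m1 + 1) (l - r) /
            pochhammer (\<alpha>2 + 1) (l - r))) *
     (pochhammer (real l - real N) (m1 + m2 - l) / pochhammer (\<alpha>1 + 1) l)"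

lemma hahn_typeII_eq_sum:
  "hahn_typeII N \<beta> \<alpha>1 \<alpha>2 m1 m2 x
    = (\<Sum>l\<le>m1 + m2. hahn_typeII_coeff N \<beta> \<alpha>1 \<alpha>2 m1 m2 l * pochhammer (- x) l)"
  unfolding hahn_typeII_def hahn_typeII_coeff_def atLeast0AtMost
  by (subst sum_distrib_left) (intro sum.cong refl, simp add: mult_ac)

text \<open>Only r = m1 contributes, since otherwise r > m1 or m1 + m2 - r > m2 makes a factor
  vanish. The sign is that of the leading coefficient of (-x)_(m1+m2), so the value expresses that
  the polynomial is monic.\<close>

lemma hahn_typeII_coeff_lead:
  assumes "\<alpha>1 > -1" "\<alpha>2 > -1" "\<beta> > -1"
  shows "hahn_typeII_coeff N \<beta> \<alpha>1 \<alpha>2 m1 m2 (m1 + m2) = (-1) ^ (m1 + m2)"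
proof -
  let ?M = "m1 + m2"
  let ?f = "\<lambda>r. pochhammer (- real m1) r * pochhammer (- real m2) (?M - r) / (fact r * fact (?M - r)) *
           pochhammer (\<alpha>1 + \<beta> + real m1 + 1 + real (?M - r)) r *
           (pochhammer (\<alpha>2 + \<beta> + real ?M + 1) (?M - r) *
              pochhammer (\<alpha>1 + real m1 + 1) (?M - r) /
            pochhammer (\<alpha>2 + 1) (?M - r))"
  have pos: "pochhammer (\<alpha>1 + 1) u > 0" "pochhammer (\<alpha>2 + 1) u > 0" for u
    using assms by (auto intro!: pochhammer_pos)
  \<comment> \<open>For \<open>?M = 0\<close> this quantity may fail to be positive, but then both
    products below are empty.\<close>
  have "\<alpha> + \<beta> + real ?M + 1 > 0" if "\<alpha> > -1" "?M \<ge> 1" for \<alpha>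
  proof -
    have "real ?M \<ge> 1" using that(2) by linarith
    then show ?thesis using that(1) assms(3) by linarith
  qed
  then have nz: "pochhammer (\<alpha>1 + \<beta> + real ?M + 1) m1 > 0" "pochhammer (\<alpha>2 + \<beta> + real ?M + 1) m2 > 0"
    using assms pochhammer_pos[of "\<alpha>1 + \<beta> + real ?M + 1" m1] pochhammer_pos[of "\<alpha>2 + \<beta> + real ?M + 1" m2]
    by (cases "m1 = 0"; cases "m2 = 0"; simp)+
  have "(\<Sum>r\<le>?M. ?f r) = (\<Sum>r\<in>{m1}. ?f r)"
  proof (rule sum.mono_neutral_right)
    show "\<forall>r\<in>{..?M} - {m1}. ?f r = 0"
    proof
      fix r assume "r \<in> {..?M} - {m1}"
      then have "m1 < r \<or> m2 < ?M - r" by auto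
      then show "?f r = 0" by (auto simp: pochhammer_of_nat_eq_0_lemma)
    qed
  qed auto
  also have "\<dots> = (-1) ^ ?M * pochhammer (\<alpha>1 + \<beta> + real ?M + 1) m1 *
      (pochhammer (\<alpha>2 + \<beta> + real ?M + 1) m2 * pochhammer (\<alpha>1 + real m1 + 1) m2 / pochhammer (\<alpha>2 + 1) m2)"
    by (simp add: pochhammer_same power_add add_ac)
  finally have "hahn_typeII_coeff N \<beta> \<alpha>1 \<alpha>2 m1 m2 ?M
      = (-1) ^ ?M * (pochhammer (\<alpha>1 + 1) m1 * pochhammer (\<alpha>1 + real m1 + 1) m2 / pochhammer (\<alpha>1 + 1) ?M)"
    unfolding hahn_typeII_coeff_def using pos[of m2] nz by simp
  also have "pochhammer (\<alpha>1 + 1) m1 * pochhammer (\<alpha>1 + real m1 + 1) m2 = pochhammer (\<alpha>1 + 1) ?M"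
    by (simp add: pochhammer_product' add_ac)
  finally show ?thesis using pos(1)[of ?M] by simp
qed

text \<open>With M = m1 + m2, the factorial (N-l)! in the moment of order \<open>l\<close> cancels
  against (l-N)_(M-l), and (z+\<beta>+2+M)_(N-M) splits off. What they leave is free of
  \<open>l\<close> and is collected in \<open>T\<close>, so the balanced double sum remains.\<close>

lemma hahn_typeII_kernel_sum:
  assumes "\<alpha>1 > -1" "\<alpha>2 > -1" and N: "m1 + m2 \<le> N"
  shows "(\<Sum>k\<le>N. hahn_typeII N \<beta> \<alpha>1 \<alpha>2 m1 m2 (real k) * hahn_kernel N \<beta> z k)
    = (-1) ^ (m1 + m2) * pochhammer (\<beta> + 1) (m1 + m2)
        * pochhammer (z + \<beta> + 2 + real (m1 + m2)) (N - (m1 + m2)) / fact (N - (m1 + m2))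
        / (pochhammer (\<alpha>1 + \<beta> + real (m1 + m2) + 1) m1 * pochhammer (\<alpha>2 + \<beta> + real (m1 + m2) + 1) m2)
        * (pochhammer (\<alpha>1 - z) m1 * pochhammer (\<alpha>2 - z) m2)"
proof -
  define M where "M = m1 + m2"
  define K where "K = pochhammer (\<alpha>1 + 1) m1 * pochhammer (\<alpha>2 + 1) m2 /
       (pochhammer (\<alpha>1 + \<beta> + real (m1 + m2) + 1) m1 * pochhammer (\<alpha>2 + \<beta> + real (m1 + m2) + 1) m2)"
  define R where "R l r = pochhammer (- real m1) r * pochhammer (- real m2) (l - r) / (fact r * fact (l - r)) *
           pochhammer (\<alpha>1 + \<beta> + real m1 + 1 + real (l - r)) r *
           (pochhammer (\<alpha>2 + \<beta> + real (m1 + m2) + 1) (l - r) *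
              pochhammer (\<alpha>1 + real m1 + 1) (l - r) /
            pochhammer (\<alpha>2 + 1) (l - r))" for l r
  define T where "T = (-1) ^ M * pochhammer (z + \<beta> + 2 + real M) (N - M) / fact (N - M)"
  define D where "D l = pochhammer (z + 1) l * pochhammer (z + \<beta> + 2 + real l) (M - l) / pochhammer (\<alpha>1 + 1) l" for l
  have pos: "pochhammer (\<alpha>1 + 1) u > 0" "pochhammer (\<alpha>2 + 1) u > 0" for u
    using assms by (auto intro!: pochhammer_pos)
  have coeff: "hahn_typeII_coeff N \<beta> \<alpha>1 \<alpha>2 m1 m2 l
      = K * (\<Sum>r\<le>l. R l r) * (pochhammer (real l - real N) (M - l) / pochhammer (\<alpha>1 + 1) l)" for l
    by (simp add: hahn_typeII_coeff_def K_def R_def M_def)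
  have "(\<Sum>k\<le>N. hahn_typeII N \<beta> \<alpha>1 \<alpha>2 m1 m2 (real k) * hahn_kernel N \<beta> z k)
      = (\<Sum>l\<le>M. hahn_typeII_coeff N \<beta> \<alpha>1 \<alpha>2 m1 m2 l * (\<Sum>k\<le>N. pochhammer (- real k) l * hahn_kernel N \<beta> z k))"
    unfolding hahn_typeII_eq_sum sum_distrib_right sum_distrib_left M_def mult.assoc by (rule sum.swap)
  also have "\<dots> = (\<Sum>l\<le>M. (K * T) * (\<Sum>r\<le>l. D l * R l r))"
  proof (rule sum.cong[OF refl])
    fix l assume "l \<in> {..M}"
    then have l: "l \<le> M" and lN: "l \<le> N" using N by (auto simp: M_def)
    have "real l - real N = - real (N - l)" using lN by simp
    moreover have "N - l - (M - l) = N - M" "M - l \<le> N - l" using l N by (auto simp: M_def)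
    ultimately have a: "pochhammer (real l - real N) (M - l) = (-1) ^ (M - l) * (fact (N - l) / fact (N - M))"
      by (metis pochhammer_minus_nat)
    have "N - l = (M - l) + (N - M)" "z + \<beta> + 2 + real l + real (M - l) = z + \<beta> + 2 + real M"
      using l N by (auto simp: M_def)
    then have b: "pochhammer (z + \<beta> + 2 + real l) (N - l)
        = pochhammer (z + \<beta> + 2 + real l) (M - l) * pochhammer (z + \<beta> + 2 + real M) (N - M)"
      by (metis pochhammer_product')
    have sgn: "(-1) ^ M = ((-1) ^ (M - l) * (-1) ^ l :: real)"
      using l by (simp flip: power_add)
    show "hahn_typeII_coeff N \<beta> \<alpha>1 \<alpha>2 m1 m2 l * (\<Sum>k\<le>N. pochhammer (- real k) l * hahn_kernel N \<beta> z k)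
      = (K * T) * (\<Sum>r\<le>l. D l * R l r)"
      unfolding coeff hahn_kernel_moment[OF lN] a b sum_distrib_left[symmetric] T_def D_def sgn
      by simp
  qed
  also have "\<dots> = (K * T) * (\<Sum>l\<le>M. \<Sum>r\<le>l. D l * R l r)"
    by (rule sum_distrib_left[symmetric])
  also have "(\<Sum>l\<le>M. \<Sum>r\<le>l. D l * R l r)
      = pochhammer (\<beta> + 1) M * pochhammer (\<alpha>1 - z) m1 * pochhammer (\<alpha>2 - z) m2
           / (pochhammer (\<alpha>1 + 1) m1 * pochhammer (\<alpha>2 + 1) m2)"
    unfolding D_def R_def M_def by (rule hahn_typeII_double_sum[OF assms(1,2)])
  finally show ?thesis
    unfolding K_def T_def M_def[symmetric] using pos[of m1] pos[of m2] by (simp add: mult_ac)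
qed

text \<open>For l \<le> N the product (l-N)_(m1+m2-l) contains the factor 0; for l > N already
  (-k)_l vanishes. This settles orthogonality for indices beyond the size of the support.\<close>

lemma hahn_typeII_eq_0:
  assumes "N < m1 + m2" "k \<le> N"
  shows "hahn_typeII N \<beta> \<alpha>1 \<alpha>2 m1 m2 (real k) = 0"
proof -
  have term0: "hahn_typeII_coeff N \<beta> \<alpha>1 \<alpha>2 m1 m2 l * pochhammer (- real k) l = 0" for l
  proof (cases "l \<le> N")
    case True
    then have "pochhammer (real l - real N) (m1 + m2 - l) = 0"
      using assms pochhammer_of_nat_eq_0_lemma[of "N - l" "m1 + m2 - l", where 'a = real] by simp
    then show ?thesis by (simp add: hahn_typeII_coeff_def)
  next
    case False
    then show ?thesis using assms by (simp add: pochhammer_of_nat_eq_0_lemma)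
  qed
  show ?thesis by (simp only: hahn_typeII_eq_sum term0 sum.neutral_const)
qed

text \<open>At \<open>z = \<alpha>1 + u\<close> the closed form of the kernel sum contains (-u)_m1,
  which is 0 for u < m1; likewise (-u)_m2 at \<open>z = \<alpha>2 + u\<close>.\<close>

lemma hahn_typeII_orthogonal:
  assumes "\<alpha>1 > -1" "\<alpha>2 > -1"
  shows "l < m1 \<Longrightarrow> (\<Sum>k\<le>N. hahn_typeII N \<beta> \<alpha>1 \<alpha>2 m1 m2 (real k) * hahn_kernel N \<beta> \<alpha>1 k * pochhammer (- real k) l) = 0"
    and "l < m2 \<Longrightarrow> (\<Sum>k\<le>N. hahn_typeII N \<beta> \<alpha>1 \<alpha>2 m1 m2 (real k) * hahn_kernel N \<beta> \<alpha>2 k * pochhammer (- real k) l) = 0"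
proof -
  have "(\<Sum>k\<le>N. hahn_typeII N \<beta> \<alpha>1 \<alpha>2 m1 m2 (real k) * hahn_kernel N \<beta> (\<alpha>1 + real u) k) = 0" if "u < m1" for u
  proof (cases "m1 + m2 \<le> N")
    case True
    show ?thesis
      unfolding hahn_typeII_kernel_sum[OF assms True] using that by (simp add: pochhammer_of_nat_eq_0_lemma)
  qed (simp add: hahn_typeII_eq_0)
  then show "l < m1 \<Longrightarrow> (\<Sum>k\<le>N. hahn_typeII N \<beta> \<alpha>1 \<alpha>2 m1 m2 (real k) * hahn_kernel N \<beta> \<alpha>1 k * pochhammer (- real k) l) = 0"
    using assms by (intro sum_kernel_pochhammer_eq_0)
  have "(\<Sum>k\<le>N. hahn_typeII N \<beta> \<alpha>1 \<alpha>2 m1 m2 (real k) * hahn_kernel N \<beta> (\<alpha>2 + real u) k) = 0" if "u < m2" for u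
  proof (cases "m1 + m2 \<le> N")
    case True
    show ?thesis
      unfolding hahn_typeII_kernel_sum[OF assms True] using that by (simp add: pochhammer_of_nat_eq_0_lemma)
  qed (simp add: hahn_typeII_eq_0)
  then show "l < m2 \<Longrightarrow> (\<Sum>k\<le>N. hahn_typeII N \<beta> \<alpha>1 \<alpha>2 m1 m2 (real k) * hahn_kernel N \<beta> \<alpha>2 k * pochhammer (- real k) l) = 0"
    using assms by (intro sum_kernel_pochhammer_eq_0)
qed

subsection \<open>Type I polynomials\<close>

lemma poly_pochhammer: "poly (pochhammer p n) x = pochhammer (poly p x :: 'a::comm_ring_1) n"
  by (induction n) (simp_all add: pochhammer_Suc)

lemma degree_pochhammer_linear: "degree (pochhammer [:c, 1 :: 'a::comm_ring_1:] n) \<le> n"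
proof (induction n)
  case (Suc n)
  have "degree ([:c, 1:] + of_nat n) \<le> 1"
    by (intro degree_add_le) auto
  then show ?case
    using Suc degree_mult_le[of "pochhammer [:c, 1:] n" "[:c, 1:] + of_nat n"]
    by (simp add: pochhammer_Suc)
qed simp

lemma AT_system_commute: "AT_system N w1 w2 \<Longrightarrow> AT_system N w2 w1"
  unfolding AT_system_def
proof (intro allI impI)
  fix n1 n2 and p1 p2 :: "real poly"
  assume AT: "\<forall>n1 n2. \<forall>p1 p2 :: real poly. n1 + n2 \<le> N + 1 \<longrightarrow>
        (p1 = 0 \<or> degree p1 < n1) \<longrightarrow> (p2 = 0 \<or> degree p2 < n2) \<longrightarrow> \<not> (p1 = 0 \<and> p2 = 0) \<longrightarrow>
        card {k \<in> {0..N}. poly p1 (real k) * w1 (real k) + poly p2 (real k) * w2 (real k) = 0} < n1 + n2"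
    and "n1 + n2 \<le> N + 1" "p1 = 0 \<or> degree p1 < n1" "p2 = 0 \<or> degree p2 < n2" "\<not> (p1 = 0 \<and> p2 = 0)"
  then have "card {k \<in> {0..N}. poly p2 (real k) * w1 (real k) + poly p1 (real k) * w2 (real k) = 0} < n2 + n1"
    by (intro AT[rule_format]) auto
  then show "card {k \<in> {0..N}. poly p1 (real k) * w2 (real k) + poly p2 (real k) * w1 (real k) = 0} < n1 + n2"
    by (simp only: add.commute)
qed

text \<open>If \<alpha>1 = \<alpha>2 + d, the first weight is the second one times a polynomial of
  degree d, up to a constant. A nontrivial combination of index (1, d + 1) then vanishes at all N +
  1 points, whereas the AT property allows at most d + 1 \<le> N zeros.\<close>

lemma AT_system_hahn_neq_add:
  assumes "AT_system N (hahn_weight N \<alpha>1 \<beta>) (hahn_weight N \<alpha>2 \<beta>)" "\<alpha>2 > -1" "\<beta> > -1" "d < N"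
  shows "\<alpha>1 \<noteq> \<alpha>2 + real d"
proof
  assume eq: "\<alpha>1 = \<alpha>2 + real d"
  let ?c = "pochhammer (\<alpha>2 + 1) d"
  let ?p1 = "[:?c:]" and ?p2 = "- pochhammer [:\<alpha>2 + 1, 1:] d"
  have c: "?c > 0" using assms by (intro pochhammer_pos) simp
  have "poly ?p1 (real k) * hahn_weight N \<alpha>1 \<beta> (real k) + poly ?p2 (real k) * hahn_weight N \<alpha>2 \<beta> (real k) = 0"
    if "k \<le> N" for k
    using that assms c by (simp add: hahn_weight_eq_kernel eq hahn_kernel_shift poly_pochhammer add_ac)
  then have "{k \<in> {0..N}. poly ?p1 (real k) * hahn_weight N \<alpha>1 \<beta> (real k)
      + poly ?p2 (real k) * hahn_weight N \<alpha>2 \<beta> (real k) = 0} = {0..N}" by auto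
  moreover have "card {k \<in> {0..N}. poly ?p1 (real k) * hahn_weight N \<alpha>1 \<beta> (real k)
      + poly ?p2 (real k) * hahn_weight N \<alpha>2 \<beta> (real k) = 0} < 1 + (d + 1)"
  proof (rule assms(1)[unfolded AT_system_def, rule_format])
    show "?p2 = 0 \<or> degree ?p2 < d + 1"
      using degree_pochhammer_linear[of "\<alpha>2 + 1" d] by (simp add: less_Suc_eq_le)
  qed (use assms(4) c in auto)
  ultimately show False using assms(4) by simp
qed

text \<open>A coincidence would make the parameters differ by the distance of \<open>i\<close> and
  \<open>j\<close>, an integer below \<open>N\<close> because \<open>n1\<close> and
  \<open>n2\<close> are both positive.\<close>

lemma AT_system_hahn_nodes:
  assumes AT: "AT_system N (hahn_weight N \<alpha>1 \<beta>) (hahn_weight N \<alpha>2 \<beta>)"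
    and "\<alpha>1 > -1" "\<alpha>2 > -1" "\<beta> > -1" "n1 + n2 \<le> N + 1" "i < n1" "j < n2"
  shows "\<alpha>1 + real i \<noteq> \<alpha>2 + real j"
proof (cases "i \<le> j")
  case True
  have "j - i < N" using assms by linarith
  with True show ?thesis
    using AT_system_hahn_neq_add[OF AT assms(3,4), of "j - i"] by auto
next
  case False
  have "i - j < N" using assms by linarith
  with False show ?thesis
    using AT_system_hahn_neq_add[OF AT_system_commute[OF AT] assms(2,4), of "i - j"] by auto
qed

section \<open>Residues at the nodes\<close>

lemma prod_lessThan_diff:
  fixes x :: "'a::comm_ring_1"
  shows "(\<Prod>k<n. x - of_nat k) = pochhammer (x - of_nat n + 1) n"
proof (induction n)
  case (Suc n)
  have "pochhammer (x - of_nat (Suc n) + 1) (Suc n) = (x - of_nat n) * pochhammer (x - of_nat n + 1) n"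
    by (simp add: pochhammer_rec)
  with Suc show ?case by (simp add: mult.commute)
qed simp

text \<open>The factors with k < i multiply to \<open>fact i\<close>, those with k > i to
  \<open>(-1) ^ (n - 1 - i) * fact (n - 1 - i)\<close>.\<close>

lemma prod_lessThan_diff_self:
  assumes "i < n"
  shows "(\<Prod>k\<in>{..<n} - {i}. of_nat i - of_nat k :: 'a::field_char_0)
    = (-1) ^ (n - 1 - i) * fact i * fact (n - 1 - i)"
  using Suc_leI[OF assms]
proof (induction n rule: dec_induct)
  case base
  have "{..<Suc i} - {i} = {..<i}" by auto
  then show ?case
    by (simp add: prod_lessThan_diff pochhammer_fact)
next
  case (step n)
  obtain m where n: "n = Suc (i + m)" using step(1) less_imp_Suc_add[of i n] by auto
  have "{..<Suc n} - {i} = insert n ({..<n} - {i})" using step by auto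
  then have "(\<Prod>k\<in>{..<Suc n} - {i}. of_nat i - of_nat k :: 'a)
      = (of_nat i - of_nat n) * ((-1) ^ (n - 1 - i) * fact i * fact (n - 1 - i))"
    using step.IH by simp
  then show ?case by (simp add: n algebra_simps)
qed

text \<open>
  With \<open>s = n + nh\<close>, this is the residue at \<open>z = \<alpha> + i\<close> of the reciprocal of
  \<open>(z + \<beta> + s)\<^bsub>N+2-s\<^esub>\<close> times the product of \<open>z - (\<alpha> + k)\<close>, \<open>k < n\<close>, and
  \<open>z - (\<alpha>h + j)\<close>, \<open>j < nh\<close>.
\<close>
definition hahn_residue :: "nat \<Rightarrow> real \<Rightarrow> real \<Rightarrow> real \<Rightarrow> nat \<Rightarrow> nat \<Rightarrow> nat \<Rightarrow> real" where
  "hahn_residue N \<beta> \<alpha> \<alpha>h n nh i =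
     1 / (pochhammer (\<alpha> + \<beta> + real (n + nh) + real i) (Suc (N + 1 - n - nh))
          * ((-1) ^ (n - 1 - i) * fact i * fact (n - 1 - i))
          * pochhammer (\<alpha> - \<alpha>h - real nh + 1 + real i) nh)"

text \<open>
  The sum of all residues vanishes; besides the nodes \<open>\<alpha>1 + i\<close> and \<open>\<alpha>2 + i\<close> only the pole
  \<open>-\<beta> - s\<close>, \<open>s = n1 + n2\<close>, is not cancelled by \<open>f\<close>, and it contributes only if \<open>j = s - 1\<close>.
\<close>
lemma sum_hahn_residues:
  fixes \<alpha>1 \<alpha>2 \<beta> :: real
  defines "f \<equiv> \<lambda>N j z. pochhammer (z + 1) j * pochhammer (z + \<beta> + 2 + real j) (N - j)"
  assumes \<alpha>: "\<alpha>1 > -1" "\<alpha>2 > -1" and \<beta>: "\<beta> > -1" and s: "2 \<le> n1 + n2" "n1 + n2 \<le> N + 1" and j: "j < n1 + n2"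
    and distinct: "\<And>i j. i < n1 \<Longrightarrow> j < n2 \<Longrightarrow> \<alpha>1 + real i \<noteq> \<alpha>2 + real j"
  shows "(\<Sum>i<n1. hahn_residue N \<beta> \<alpha>1 \<alpha>2 n1 n2 i * f N j (\<alpha>1 + real i))
       + (\<Sum>i<n2. hahn_residue N \<beta> \<alpha>2 \<alpha>1 n2 n1 i * f N j (\<alpha>2 + real i))
     = (if j = n1 + n2 - 1
        then pochhammer (\<beta> + 1) (n1 + n2 - 1) / (pochhammer (\<alpha>1 + \<beta> + real (n1 + n2)) n1
          * pochhammer (\<alpha>2 + \<beta> + real (n1 + n2)) n2)
        else 0)"
proof -
  define s where "s = n1 + n2"
  define b where "b = - \<beta> - real s"
  \<comment> \<open>\<open>f N j\<close> is \<open>P\<close> times (z+\<beta>+s+1)_(N+1-s), which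
    cancels every zero of (z+\<beta>+s)_(N+2-s) except \<open>b\<close>. The residue sum thus
    becomes a divided difference of \<open>P\<close>, of degree at most s - 1, over s + 1
    points.\<close>
  define P where "P = pochhammer [:1, 1:] j * pochhammer [:\<beta> + 2 + real j, 1:] (s - 1 - j)"
  define X where "X a n = (\<lambda>i. a + real i) ` {..<n}" for a n
  have P: "poly P z = pochhammer (z + 1) j * pochhammer (z + \<beta> + 2 + real j) (s - 1 - j)" for z
    by (simp add: P_def poly_pochhammer add_ac)
  have s2: "s \<ge> 2" "s \<le> N + 1" "j < s" using assms by (auto simp: s_def)
  \<comment> \<open>Because of s \<ge> 2 the extra pole \<open>b\<close> lies strictly to the left
    of all nodes.\<close>
  have bneg: "a + real i - b > 0" if "a > -1" for a i
    using that \<beta> s2 by (simp add: b_def)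
  have fin: "finite (X a n)" and inj: "inj_on (\<lambda>i. a + real i) {..<n}" and card: "card (X a n) = n" for a n
    by (auto simp: X_def inj_on_def card_image)
  have bX: "b \<notin> X \<alpha>1 n1" "b \<notin> X \<alpha>2 n2"
    using bneg[OF \<alpha>(1)] bneg[OF \<alpha>(2)] by (force simp: X_def)+
  have disj: "X \<alpha>1 n1 \<inter> X \<alpha>2 n2 = {}"
    using distinct by (auto simp: X_def)
  have prodX: "(\<Prod>y\<in>X a n. x - y) = pochhammer (x - a - real n + 1) n" for a n x
    using prod_lessThan_diff[of "x - a" n] by (simp add: X_def prod.reindex[OF inj] diff_diff_eq)
  have prodX_self: "(\<Prod>y\<in>X a n - {a + real i}. a + real i - y) = (-1) ^ (n - 1 - i) * fact i * fact (n - 1 - i)"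
    if "i < n" for a n i
  proof -
    have "X a n - {a + real i} = (\<lambda>i. a + real i) ` ({..<n} - {i})" by (auto simp: X_def)
    moreover have "inj_on (\<lambda>i. a + real i) ({..<n} - {i})" by (auto simp: inj_on_def)
    ultimately show ?thesis
      using prod_lessThan_diff_self[OF that, where 'a = real] by (simp add: prod.reindex)
  qed
  let ?X = "insert b (X \<alpha>1 n1 \<union> X \<alpha>2 n2)"
  have cardX: "card ?X = s + 1"
    using bX disj by (simp add: fin card card_Un_disjoint s_def)
  have "degree P \<le> j + (s - 1 - j)"
    unfolding P_def by (intro order_trans[OF degree_mult_le] add_mono degree_pochhammer_linear)
  then have "degree P + 1 < card ?X" using cardX s2 by simp
  then have "(\<Sum>x\<in>?X. poly P x / (\<Prod>y\<in>?X - {x}. x - y)) = 0"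
    by (intro divided_difference_eq_0) (simp_all add: fin)
  also have "(\<Sum>x\<in>?X. poly P x / (\<Prod>y\<in>?X - {x}. x - y)) = poly P b / (\<Prod>y\<in>?X - {b}. b - y)
      + ((\<Sum>x\<in>X \<alpha>1 n1. poly P x / (\<Prod>y\<in>?X - {x}. x - y)) + (\<Sum>x\<in>X \<alpha>2 n2. poly P x / (\<Prod>y\<in>?X - {x}. x - y)))"
    using bX disj by (simp add: fin sum.union_disjoint)
  finally have total: "(\<Sum>x\<in>X \<alpha>1 n1. poly P x / (\<Prod>y\<in>?X - {x}. x - y)) + (\<Sum>x\<in>X \<alpha>2 n2. poly P x / (\<Prod>y\<in>?X - {x}. x - y))
      = - (poly P b / (\<Prod>y\<in>?X - {b}. b - y))" by simp
  have node: "(\<Sum>x\<in>X a n. poly P x / (\<Prod>y\<in>insert b (X a n \<union> X a' n') - {x}. x - y))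
      = (\<Sum>i<n. hahn_residue N \<beta> a a' n n' i * f N j (a + real i))"
    if n: "n + n' = s" and a: "a > -1" and b: "b \<notin> X a n" "b \<notin> X a' n'" and disj: "X a n \<inter> X a' n' = {}" for a a' n n'
  proof -
    have "poly P (a + real i) / (\<Prod>y\<in>insert b (X a n \<union> X a' n') - {a + real i}. a + real i - y)
      = hahn_residue N \<beta> a a' n n' i * f N j (a + real i)" if i: "i < n" for i
    proof -
      let ?x = "a + real i"
      have x: "?x \<in> X a n" using i by (auto simp: X_def)
      then have "insert b (X a n \<union> X a' n') - {?x} = insert b ((X a n - {?x}) \<union> X a' n')"
        using b disj by auto
      moreover have "(X a n - {?x}) \<inter> X a' n' = {}" using disj by auto
      ultimately have prod: "(\<Prod>y\<in>insert b (X a n \<union> X a' n') - {?x}. ?x - y)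
          = (?x - b) * (((-1) ^ (n - 1 - i) * fact i * fact (n - 1 - i)) * pochhammer (?x - a' - real n' + 1) n')"
        using b prodX_self[OF i] by (simp add: fin prod.union_disjoint prodX)
      have "N - j = (s - 1 - j) + (N + 1 - s)" "?x + \<beta> + 2 + real j + real (s - 1 - j) = ?x - b + 1"
        using s2 by (auto simp: b_def of_nat_diff)
      then have F: "f N j ?x = poly P ?x * pochhammer (?x - b + 1) (N + 1 - s)"
        unfolding f_def P by (metis pochhammer_product' mult.assoc)
      have "a + \<beta> + real (n + n') + real i = ?x - b" "N + 1 - n - n' = N + 1 - s"
        "a - a' - real n' + 1 + real i = ?x - a' - real n' + 1"
        using n by (auto simp: b_def)
      then have R: "hahn_residue N \<beta> a a' n n' i = 1 / (((?x - b) * pochhammer (?x - b + 1) (N + 1 - s))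
          * ((-1) ^ (n - 1 - i) * fact i * fact (n - 1 - i)) * pochhammer (?x - a' - real n' + 1) n')"
        unfolding hahn_residue_def by (simp only: pochhammer_rec)
      have "pochhammer (?x - b + 1) (N + 1 - s) > 0"
        using bneg[OF a, of i] by (intro pochhammer_pos) simp
      then show ?thesis
        unfolding prod F R by simp
    qed
    then show ?thesis
      unfolding X_def sum.reindex[OF inj] o_def by (intro sum.cong refl) (auto simp: X_def)
  qed
  have prodb: "(\<Prod>y\<in>X a n. b - y) = (-1) ^ n * pochhammer (a + \<beta> + real s) n" for a n
  proof -
    have "b - a - real n + 1 = 1 - (a + \<beta> + real s) - real n" by (simp add: b_def)
    then show ?thesis unfolding prodX by (simp only: pochhammer_complement)
  qed
  have pos: "pochhammer (a + \<beta> + real s) n > 0" if "a > -1" for a n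
    using that \<beta> s2 by (intro pochhammer_pos) simp
  have "?X - {b} = X \<alpha>1 n1 \<union> X \<alpha>2 n2" using bX by auto
  then have prodb2: "(\<Prod>y\<in>?X - {b}. b - y) = (-1) ^ s * (pochhammer (\<alpha>1 + \<beta> + real s) n1 * pochhammer (\<alpha>2 + \<beta> + real s) n2)"
    using disj by (simp add: fin prod.union_disjoint prodb s_def power_add)
  \<comment> \<open>For j < s - 1 the factors of the second product of \<open>P\<close> at
    \<open>b\<close> run from -(s-2-j) up to 0.\<close>
  have Pb: "poly P b = (if j = s - 1 then (-1) ^ (s - 1) * pochhammer (\<beta> + 1) (s - 1) else 0)"
  proof (cases "j = s - 1")
    case True
    have "b + 1 = 1 - (\<beta> + 1) - real (s - 1)" using s2 by (simp add: b_def of_nat_diff)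
    then have "pochhammer (b + 1) (s - 1) = (-1) ^ (s - 1) * pochhammer (\<beta> + 1) (s - 1)"
      by (simp only: pochhammer_complement)
    then show ?thesis using True by (simp add: P)
  next
    case False
    then have "b + \<beta> + 2 + real j = - real (s - 2 - j)" "s - 1 - j > s - 2 - j"
      using s2 by (auto simp: b_def of_nat_diff)
    then have "pochhammer (b + \<beta> + 2 + real j) (s - 1 - j) = 0"
      by (simp only: pochhammer_of_nat_eq_0_lemma)
    then show ?thesis using False by (simp add: P)
  qed
  have "(\<Sum>i<n1. hahn_residue N \<beta> \<alpha>1 \<alpha>2 n1 n2 i * f N j (\<alpha>1 + real i))
       + (\<Sum>i<n2. hahn_residue N \<beta> \<alpha>2 \<alpha>1 n2 n1 i * f N j (\<alpha>2 + real i)) = - (poly P b / (\<Prod>y\<in>?X - {b}. b - y))"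
    using total node[of n1 n2 \<alpha>1 \<alpha>2] node[of n2 n1 \<alpha>2 \<alpha>1] bX disj \<alpha>
    by (simp add: s_def Un_commute Int_commute add.commute)
  also have "\<dots> = (if j = s - 1 then pochhammer (\<beta> + 1) (s - 1) / (pochhammer (\<alpha>1 + \<beta> + real s) n1
          * pochhammer (\<alpha>2 + \<beta> + real s) n2) else 0)"
  proof -
    obtain t where t: "s = Suc t" using s2 by (cases s) auto
    show ?thesis unfolding Pb prodb2 unfolding t by (simp add: divide_simps)
  qed
  finally show ?thesis by (simp only: s_def)
qed

section \<open>Explicit type I coefficients as residue sums\<close>

text \<open>The normalization that gives the linear form the moment (-1)^(n+nh-1) of order n + nh -
  1. It is symmetric in the two components, so both carry the same constant.\<close>

definition hahn_typeI_norm :: "nat \<Rightarrow> real \<Rightarrow> real \<Rightarrow> real \<Rightarrow> nat \<Rightarrow> nat \<Rightarrow> real" where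
  "hahn_typeI_norm N \<beta> \<alpha> \<alpha>h n nh =
     fact (N + 1 - n - nh) * pochhammer (\<alpha> + \<beta> + real (n + nh)) n
       * pochhammer (\<alpha>h + \<beta> + real (n + nh)) nh / pochhammer (\<beta> + 1) (n + nh - 1)"

lemma hahn_typeI_norm_commute:
  "hahn_typeI_norm N \<beta> \<alpha> \<alpha>h n nh = hahn_typeI_norm N \<beta> \<alpha>h \<alpha> nh n"
  by (simp add: hahn_typeI_norm_def add.commute mult_ac)

text \<open>The identity (B+u)_q = (B)_q (B+q)_u / (B)_u exhibits the residue at \<alpha> + l + u as
  a hypergeometric term in \<open>u\<close>. The binomial coefficient stems from expanding
  (\<alpha>+1+x)_(l+u) in the basis (-x)_l.\<close>

lemma hahn_residue_binomial:
  assumes "\<alpha> > -1" "\<beta> > -1" "n = Suc (l + p)" "2 \<le> n + nh" "n + nh \<le> N + 1" "u \<le> p"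
    and B: "B = \<alpha> + \<beta> + real (n + nh) + real l" and C: "C = \<alpha> - \<alpha>h - real nh + 1 + real l"
    and q: "q = Suc (N + 1 - n - nh)"
  shows "hahn_residue N \<beta> \<alpha> \<alpha>h n nh (l + u) * real ((l + u) choose l)
    = (-1) ^ p / (fact l * fact p * pochhammer B q)
      * ((-1) ^ u * real (p choose u) * (pochhammer B u / pochhammer (B + real q) u)
         / pochhammer (C + real u) nh)"
proof -
  have "B > 0" using assms by simp
  then have pos: "pochhammer B i > 0" "pochhammer (B + real q) i > 0" "pochhammer (B + real u) i > 0" for i
    by (auto intro!: pochhammer_pos)
  have "pochhammer B u * pochhammer (B + real u) q = pochhammer B q * pochhammer (B + real q) u"
    by (metis pochhammer_product' add.commute)
  then have shift: "pochhammer (B + real u) q = pochhammer B q * pochhammer (B + real q) u / pochhammer B u"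
    using pos(1)[of u] by (simp add: field_simps)
  have "n - 1 - (l + u) = p - u" using assms by simp
  moreover have "\<alpha> + \<beta> + real (n + nh) + real (l + u) = B + real u"
    "\<alpha> - \<alpha>h - real nh + 1 + real (l + u) = C + real u" by (simp_all add: B C)
  ultimately have R: "hahn_residue N \<beta> \<alpha> \<alpha>h n nh (l + u)
      = 1 / (pochhammer (B + real u) q * ((-1) ^ (p - u) * fact (l + u) * fact (p - u)) * pochhammer (C + real u) nh)"
    by (simp only: hahn_residue_def q)
  have sgn: "(-1) ^ (p - u) = ((-1) ^ p * (-1) ^ u :: real)"
    using \<open>u \<le> p\<close> by (simp flip: power_add add: minus_one_power_iff)
  have b1: "real ((l + u) choose l) = fact (l + u) / (fact l * fact u)"
    using binomial_fact[of l "l + u", where 'a = real] by simp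
  have b2: "real (p choose u) = fact p / (fact u * fact (p - u))"
    using \<open>u \<le> p\<close> by (rule binomial_fact)
  have inv: "1 / ((-1) ^ k) = ((-1) ^ k :: real)" for k
    by (cases "even k") auto
  have "hahn_residue N \<beta> \<alpha> \<alpha>h n nh (l + u) * real ((l + u) choose l)
    = (1 / (-1) ^ p) * (1 / (-1) ^ u) * (pochhammer B u / (fact l * fact u * fact (p - u) * pochhammer B q
      * pochhammer (B + real q) u * pochhammer (C + real u) nh))"
    unfolding R b1 sgn shift by (simp add: mult_ac)
  then show ?thesis
    unfolding inv b2 by (simp add: mult_ac)
qed

text \<open>Without a second family of nodes the residue sum is a multiple of 2F1(-p, B; B+q; 1),
  which Chu-Vandermonde evaluates in closed form.\<close>

lemma hahn_typeI_coeff_eq_residues_0: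
  assumes "\<alpha> > -1" "\<beta> > -1" "l < n" "2 \<le> n" "n \<le> N + 1"
  shows "hahn_typeI_coeff N \<beta> \<alpha> \<alpha>h n 0 l = hahn_typeI_norm N \<beta> \<alpha> \<alpha>h n 0 * (-1) ^ l / pochhammer (\<alpha> + 1) l
    * (\<Sum>u\<le>n - 1 - l. hahn_residue N \<beta> \<alpha> \<alpha>h n 0 (l + u) * real ((l + u) choose l))"
proof -
  define p where "p = n - 1 - l"
  define q where "q = Suc (N + 1 - n)"
  define B where "B = \<alpha> + \<beta> + real n + real l"
  have n: "n = Suc (l + p)" using assms by (simp add: p_def)
  have Bpos: "B > 0" "\<alpha> + \<beta> + real n > 0" using assms by (auto simp: B_def)
  have pos: "pochhammer B i > 0" "pochhammer (B + real i) j > 0" "pochhammer (\<alpha> + \<beta> + real n) i > 0"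
    "pochhammer (\<alpha> + \<beta> + real n + real j) i > 0" "pochhammer (\<beta> + 1) i > 0"
    "pochhammer (\<alpha> + 1) i > 0" for i j
    using Bpos assms by (auto intro!: pochhammer_pos)
  have "(\<Sum>u\<le>p. hahn_residue N \<beta> \<alpha> \<alpha>h n 0 (l + u) * real ((l + u) choose l))
      = (\<Sum>u\<le>p. (-1) ^ p / (fact l * fact p * pochhammer B q)
          * ((-1) ^ u * real (p choose u) * (pochhammer B u / pochhammer (B + real q) u)))"
    using assms n hahn_residue_binomial[of \<alpha> \<beta> n l p 0 N _ B _ \<alpha>h q]
    by (intro sum.cong refl) (simp add: B_def q_def)
  also have "\<dots> = (-1) ^ p / (fact l * fact p * pochhammer B q) *
      (\<Sum>u\<le>p. (-1) ^ u * real (p choose u) * (pochhammer B u / pochhammer (B + real q) u))"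
    by (rule sum_distrib_left[symmetric])
  also have "(\<Sum>u\<le>p. (-1) ^ u * real (p choose u) * (pochhammer B u / pochhammer (B + real q) u))
      = (\<Sum>u\<le>p. (-1) ^ u * real (p choose u) * pochhammer B u * pochhammer (B + real q + real u) (p - u)
          / pochhammer (B + real q) p)"
  proof (rule sum.cong[OF refl])
    fix u assume "u \<in> {..p}"
    then have "pochhammer (B + real q) p = pochhammer (B + real q) u * pochhammer (B + real q + real u) (p - u)"
      by (intro pochhammer_product) simp
    moreover have "pochhammer (B + real q + real u) (p - u) > 0"
      using Bpos by (intro pochhammer_pos) simp
    ultimately show "(-1) ^ u * real (p choose u) * (pochhammer B u / pochhammer (B + real q) u)
      = (-1) ^ u * real (p choose u) * pochhammer B u * pochhammer (B + real q + real u) (p - u)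
          / pochhammer (B + real q) p" by simp
  qed
  also have "\<dots> = pochhammer (real q) p / pochhammer (B + real q) p"
    unfolding sum_divide_distrib[symmetric] chu_vandermonde by simp
  finally have S: "(\<Sum>u\<le>p. hahn_residue N \<beta> \<alpha> \<alpha>h n 0 (l + u) * real ((l + u) choose l))
     = (-1) ^ p / (fact l * fact p * pochhammer B q) * (pochhammer (real q) p / pochhammer (B + real q) p)" .
  have "N + 1 - n + p = N - l" using n assms by simp
  then have f1: "fact (N + 1 - n) * pochhammer (real q) p = fact (N - l)"
    using pochhammer_product'[of "1::real" "N + 1 - n" p] by (simp add: q_def pochhammer_fact add_ac del: of_nat_diff)
  \<comment> \<open>Both sides are (\<alpha>+\<beta>+n)_(N+1), cut at different places.\<close>
  have f2: "pochhammer (\<alpha> + \<beta> + real n) l * (pochhammer B q * pochhammer (B + real q) p)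
      = pochhammer (\<alpha> + \<beta> + real n) n * pochhammer (\<alpha> + \<beta> + real (2 * n)) (N + 1 - n)"
  proof -
    have "l + (q + p) = n + (N + 1 - n)" using n by (simp add: q_def)
    moreover have "\<alpha> + \<beta> + real n + real n = \<alpha> + \<beta> + real (2 * n)" by simp
    ultimately show ?thesis unfolding B_def by (metis pochhammer_product')
  qed
  have f3: "pochhammer (1 - real n) l = (-1) ^ l * (fact (n - 1) / fact p)"
    using pochhammer_minus_nat[of l "n - 1", where 'a = real] n by (simp add: algebra_simps)
  have f4: "pochhammer (- real N) l = (-1) ^ l * (fact N / fact (N - l))"
    using assms by (intro pochhammer_minus_nat) simp
  have sgn: "(-1) ^ (n - 1) = ((-1) ^ l * (-1) ^ p :: real)" using n by (simp add: power_add)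
  have pos2: "pochhammer (\<alpha> + \<beta> + real (2 * n)) (N + 1 - n) > 0"
    using assms by (intro pochhammer_pos) simp
  have f2': "pochhammer (\<alpha> + \<beta> + real n) n / (pochhammer B q * pochhammer (B + real q) p)
      = pochhammer (\<alpha> + \<beta> + real n) l / pochhammer (\<alpha> + \<beta> + real (2 * n)) (N + 1 - n)"
    using f2 pos pos2 by (simp add: frac_eq_eq less_imp_neq[symmetric] mult_ac)
  have "hahn_typeI_coeff N \<beta> \<alpha> \<alpha>h n 0 l = (-1) ^ l * (-1) ^ p * fact (N - l) / (fact l * fact p *
      pochhammer (\<beta> + 1) (n - 1) * pochhammer (\<alpha> + 1) l)
      * (pochhammer (\<alpha> + \<beta> + real n) l / pochhammer (\<alpha> + \<beta> + real (2 * n)) (N + 1 - n))"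
    unfolding hahn_typeI_coeff_def f3 f4 sgn by (simp add: mult_ac)
  also have "\<dots> = hahn_typeI_norm N \<beta> \<alpha> \<alpha>h n 0 * (-1) ^ l / pochhammer (\<alpha> + 1) l
     * ((-1) ^ p / (fact l * fact p * pochhammer B q) * (pochhammer (real q) p / pochhammer (B + real q) p))"
    unfolding f2'[symmetric] f1[symmetric] hahn_typeI_norm_def by (simp add: mult_ac)
  finally show ?thesis unfolding p_def[symmetric] S .
qed

text \<open>Up to constants, the residue sum is \<open>G\<close>, that is 3F2(-p, B, C; d, e; 1),
  and the sum over \<open>m\<close> in the explicit formula is \<open>W\<close>, another terminating
  3F2. The Thomae-type transformation relates the two; the rest compares prefactors.\<close>

lemma hahn_typeI_coeff_eq_residues_pos:
  assumes "\<alpha> > -1" "\<alpha>h > -1" "\<beta> > -1" "l < n" "0 < nh" "n + nh \<le> N + 1"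
    and distinct: "\<And>i j. i < n \<Longrightarrow> j < nh \<Longrightarrow> \<alpha> + real i \<noteq> \<alpha>h + real j"
  shows "hahn_typeI_coeff N \<beta> \<alpha> \<alpha>h n nh l = hahn_typeI_norm N \<beta> \<alpha> \<alpha>h n nh * (-1) ^ l / pochhammer (\<alpha> + 1) l
    * (\<Sum>u\<le>n - 1 - l. hahn_residue N \<beta> \<alpha> \<alpha>h n nh (l + u) * real ((l + u) choose l))"
proof -
  define p where "p = n - 1 - l"
  define r where "r = N + 1 - n - nh"
  define q where "q = Suc r"
  define A where "A = \<alpha> + \<beta> + real (n + nh)"
  define B where "B = A + real l"
  define D where "D = \<alpha> - \<alpha>h - real nh + 1"
  define C where "C = D + real l"
  define d where "d = B + real q"
  define e where "e = C + real nh"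
  define E0 where "E0 = \<alpha>h + \<beta> + real nh + 1"
  define E where "E = E0 + real l"
  have n: "n = Suc (l + p)" using assms by (simp add: p_def)
  have Apos: "A > 0" "B > 0" "d > 0" "E0 > 0" "E > 0"
    using assms by (auto simp: A_def B_def d_def E0_def E_def)
  have pos: "pochhammer A i > 0" "pochhammer B i > 0" "pochhammer d i > 0" "pochhammer E0 i > 0"
    "pochhammer E i > 0" "pochhammer (\<beta> + 1) i > 0" "pochhammer (\<alpha> + 1) i > 0"
    "pochhammer (A + real n) i > 0" "pochhammer (E + real i) j > 0" "pochhammer (d + real i) j > 0" for i j
    using Apos assms by (auto intro!: pochhammer_pos)
  \<comment> \<open>As \<open>D\<close> is \<alpha> - \<alpha>h - (nh - 1), the factors are exactly
    the values taken by the differences (\<alpha> + i) - (\<alpha>h + j) with i < n, j < nh.\<close>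
  have D0: "pochhammer D (n + nh - 1) \<noteq> 0"
  proof
    assume "pochhammer D (n + nh - 1) = 0"
    then obtain k where k: "k < n + nh - 1" "D = - real k" by (auto simp: pochhammer_eq_0_iff)
    show False
    proof (cases "k < nh")
      case True
      then have "\<alpha> + real 0 = \<alpha>h + real (nh - 1 - k)" using k by (simp add: D_def)
      then show False using distinct[of 0 "nh - 1 - k"] True assms by simp
    next
      case False
      then have "\<alpha> + real (k - (nh - 1)) = \<alpha>h + real 0" using k assms by (simp add: D_def of_nat_diff)
      moreover have "k - (nh - 1) < n" using False k assms by linarith
      ultimately show False using distinct[of "k - (nh - 1)" 0] assms(5) by blast
    qed
  qed
  have Dsplit: "pochhammer D (n + nh - 1) = pochhammer D l * (pochhammer C nh * pochhammer e p)"
  proof -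
    have "n + nh - 1 = l + (nh + p)" using n by simp
    then show ?thesis by (simp only: pochhammer_product' C_def e_def)
  qed
  have Dnz: "pochhammer D l \<noteq> 0" "pochhammer C nh \<noteq> 0" "pochhammer e p \<noteq> 0"
    using D0 Dsplit by auto
  have enz: "pochhammer e i \<noteq> 0" if "i \<le> p" for i
    using Dnz(3) pochhammer_neq_0_mono that by blast
  define W where "W = (\<Sum>m\<le>p. (-1) ^ m * real (p choose m) * pochhammer (- real N + real l) m
      * pochhammer (\<alpha>h - \<alpha> - real n + 1) m / (pochhammer (- real n - real nh + 2 + real l) m * pochhammer E m))"
  define G where "G = (\<Sum>u\<le>p. (-1) ^ u * real (p choose u) * pochhammer C u * pochhammer B u
      / (pochhammer e u * pochhammer d u))"
  have quot: "pochhammer (x + real i) (p - i) = pochhammer x p / pochhammer x i"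
    if "i \<le> p" "pochhammer x i > 0" for x :: real and i
    using pochhammer_product[OF that(1), of x] that(2) by simp
  \<comment> \<open>The transformation is used with numerator parameters \<open>C\<close> and
    \<open>B\<close>; \<open>eqs\<close> identifies the new parameters with those of the explicit
    formula. Since e - C = nh > 0, the factor (e-C)_p is nonzero.\<close>
  have GW: "pochhammer e p * (pochhammer d p * G) = pochhammer (real nh) p * (pochhammer E p * W)"
  proof -
    have eqs: "1 - (d + e - C - B + real p) = - real N + real l"
      "1 - e - real p = \<alpha>h - \<alpha> - real n + 1" "1 + B - e - real p = E"
      "1 + C - e - real p = - real n - real nh + 2 + real l" "e - C = real nh"
      using n assms by (simp_all add: d_def e_def C_def B_def q_def r_def A_def D_def E_def E0_def of_nat_diff)
    have "pochhammer (e - C) p \<noteq> 0" "pochhammer d p \<noteq> 0"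
      using assms pochhammer_pos[of "real nh" p] pos(3)[of p] by (simp_all add: e_def)
    then have "pochhammer e p * (\<Sum>i\<le>p. (-1) ^ i * real (p choose i) * pochhammer C i * pochhammer B i
            * pochhammer (d + real i) (p - i) / pochhammer e i)
       = pochhammer (real nh) p * (\<Sum>i\<le>p. (-1) ^ i * real (p choose i)
            * pochhammer (- real N + real l) i * pochhammer (\<alpha>h - \<alpha> - real n + 1) i
            * pochhammer (E + real i) (p - i) / pochhammer (- real n - real nh + 2 + real l) i)"
      using thomae_terminating[of d p e C B] Dnz(3) by (simp only: eqs simp_thms)
    also have "(\<Sum>i\<le>p. (-1) ^ i * real (p choose i) * pochhammer C i * pochhammer B i
            * pochhammer (d + real i) (p - i) / pochhammer e i) = pochhammer d p * G"
      unfolding G_def sum_distrib_left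
      by (intro sum.cong refl) (simp add: quot pos mult_ac)
    also have "(\<Sum>i\<le>p. (-1) ^ i * real (p choose i)
            * pochhammer (- real N + real l) i * pochhammer (\<alpha>h - \<alpha> - real n + 1) i
            * pochhammer (E + real i) (p - i) / pochhammer (- real n - real nh + 2 + real l) i) = pochhammer E p * W"
      unfolding W_def sum_distrib_left
      by (intro sum.cong refl) (simp add: quot pos mult_ac)
    finally show ?thesis .
  qed
  have "(\<Sum>u\<le>p. hahn_residue N \<beta> \<alpha> \<alpha>h n nh (l + u) * real ((l + u) choose l))
      = (\<Sum>u\<le>p. (-1) ^ p / (fact l * fact p * pochhammer B q) / pochhammer C nh
          * ((-1) ^ u * real (p choose u) * pochhammer C u * pochhammer B u / (pochhammer e u * pochhammer d u)))"
  proof (rule sum.cong[OF refl])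
    fix u assume "u \<in> {..p}"
    then have u: "u \<le> p" by simp
    have "pochhammer C u * pochhammer (C + real u) nh = pochhammer C nh * pochhammer e u"
      unfolding e_def by (metis pochhammer_product' add.commute)
    moreover from this have "pochhammer (C + real u) nh \<noteq> 0"
      using enz[OF u] Dnz(2) by auto
    ultimately have "1 / pochhammer (C + real u) nh = pochhammer C u / (pochhammer C nh * pochhammer e u)"
      using enz[OF u] Dnz(2) by (simp add: frac_eq_eq)
    moreover have "hahn_residue N \<beta> \<alpha> \<alpha>h n nh (l + u) * real ((l + u) choose l)
      = (-1) ^ p / (fact l * fact p * pochhammer B q)
      * ((-1) ^ u * real (p choose u) * (pochhammer B u / pochhammer d u) * (1 / pochhammer (C + real u) nh))"
      using hahn_residue_binomial[of \<alpha> \<beta> n l p nh N u B C \<alpha>h q] assms n u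
      by (simp add: B_def C_def A_def D_def d_def q_def r_def)
    ultimately show "hahn_residue N \<beta> \<alpha> \<alpha>h n nh (l + u) * real ((l + u) choose l)
      = (-1) ^ p / (fact l * fact p * pochhammer B q) / pochhammer C nh
          * ((-1) ^ u * real (p choose u) * pochhammer C u * pochhammer B u / (pochhammer e u * pochhammer d u))"
      by (simp add: mult_ac)
  qed
  also have "\<dots> = (-1) ^ p / (fact l * fact p * pochhammer B q) / pochhammer C nh * G"
    unfolding G_def by (rule sum_distrib_left[symmetric])
  also have "G = pochhammer (real nh) p * pochhammer E p * W / (pochhammer e p * pochhammer d p)"
    using GW Dnz(3) pos(3)[of p] by (simp add: field_simps)
  finally have S: "(\<Sum>u\<le>p. hahn_residue N \<beta> \<alpha> \<alpha>h n nh (l + u) * real ((l + u) choose l))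
      = (-1) ^ p / (fact l * fact p * pochhammer B q) / pochhammer C nh
        * (pochhammer (real nh) p * pochhammer E p * W / (pochhammer e p * pochhammer d p))" .
  have f4: "pochhammer (- real N) l \<noteq> 0"
    using assms by (simp add: pochhammer_of_nat_eq_0_iff)
  \<comment> \<open>The first \<open>l\<close> factors are split off each symbol of index l + m;
    then (1-n+l)_m = (-p)_m supplies the signed binomial coefficient of \<open>W\<close>.\<close>
  have T: "(\<Sum>m = 0..n - 1 - l.
           pochhammer (- real n + 1) (l + m) * pochhammer (- real N) (l + m) *
             pochhammer (\<alpha>h - \<alpha> - real n + 1) m /
           (fact m * pochhammer (- real n - real nh + 2) (l + m) * pochhammer E0 (l + m)))
    = pochhammer (- real n + 1) l * pochhammer (- real N) l / (pochhammer (- real n - real nh + 2) l * pochhammer E0 l) * W"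
    unfolding W_def sum_distrib_left p_def[symmetric] atLeast0AtMost
  proof (rule sum.cong[OF refl])
    fix m
    have arg: "- real n + 1 + real l = - real p" using n by simp
    have a: "pochhammer (- real n + 1 + real l) m = fact m * ((-1) ^ m * real (p choose m))"
      unfolding arg using pochhammer_minus_binomial[of p m, where 'a = real] by (simp add: field_simps)
    show "pochhammer (- real n + 1) (l + m) * pochhammer (- real N) (l + m) *
             pochhammer (\<alpha>h - \<alpha> - real n + 1) m /
           (fact m * pochhammer (- real n - real nh + 2) (l + m) * pochhammer E0 (l + m))
      = pochhammer (- real n + 1) l * pochhammer (- real N) l / (pochhammer (- real n - real nh + 2) l * pochhammer E0 l)
        * ((-1) ^ m * real (p choose m) * pochhammer (- real N + real l) m
      * pochhammer (\<alpha>h - \<alpha> - real n + 1) m / (pochhammer (- real n - real nh + 2 + real l) m * pochhammer E m))"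
      unfolding pochhammer_product' a E_def by (simp add: mult_ac)
  qed
  \<comment> \<open>Both sides are (A)_(N+1-nh), cut at different places.\<close>
  have f2: "pochhammer A l * (pochhammer B q * pochhammer d p) = pochhammer A n * pochhammer (A + real n) r"
  proof -
    have "l + (q + p) = n + r" using n by (simp add: q_def)
    then show ?thesis unfolding B_def d_def by (metis pochhammer_product')
  qed
  have f3: "pochhammer E0 (n + nh - 1) = pochhammer E0 l * pochhammer E p * pochhammer (\<alpha>h + \<beta> + real (n + nh)) nh"
  proof -
    have "n + nh - 1 = l + (p + nh)" "E + real p = \<alpha>h + \<beta> + real (n + nh)" using n by (simp_all add: E_def E0_def)
    then show ?thesis by (simp only: pochhammer_product' E_def mult.assoc)
  qed
  obtain h where h: "nh = Suc h" using assms by (cases nh) auto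
  have "fact (h + p) = fact h * pochhammer (1 + real h) p"
    by (simp only: pochhammer_fact pochhammer_product')
  then have f5: "pochhammer (real nh) p = fact (h + p) / fact h"
    by (simp add: h)
  have f6: "pochhammer (- real n + 1) l = (-1) ^ l * (fact (n - 1) / fact p)"
    using pochhammer_minus_nat[of l "n - 1", where 'a = real] n by (simp add: algebra_simps)
  have f7: "pochhammer (- real n - real nh + 2) l = (-1) ^ l * (fact (n + nh - 2) / fact (h + p))"
    using pochhammer_minus_nat[of l "n + nh - 2", where 'a = real] n h by (simp add: algebra_simps)
  have sgn: "(-1) ^ (n - 1) = ((-1) ^ l * (-1) ^ p :: real)" using n by (simp add: power_add)
  have arg: "\<alpha> + \<beta> + real (n + nh + n) = A + real n" by (simp add: A_def)
  have nh1: "nh - 1 = h" by (simp add: h)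
  have K: "hahn_typeI_const N \<beta> \<alpha> \<alpha>h n nh = (-1) ^ l * (-1) ^ p * fact r * fact (n + nh - 2) /
       (fact (n - 1) * fact h * pochhammer (\<beta> + 1) (n + nh - 1) * pochhammer (A + real n) r) *
     (pochhammer E0 l * pochhammer E p * pochhammer (\<alpha>h + \<beta> + real (n + nh)) nh /
       (pochhammer D l * (pochhammer C nh * pochhammer e p)))"
    unfolding hahn_typeI_const_def sgn E0_def[symmetric] D_def[symmetric] f3 Dsplit r_def[symmetric] arg nh1
    by simp
  have f2': "pochhammer A n / (pochhammer B q * pochhammer d p) = pochhammer A l / pochhammer (A + real n) r"
    using f2 pos[of p] pos[of q] pos[of r] by (simp add: frac_eq_eq less_imp_neq[symmetric] mult_ac)
  have norm: "hahn_typeI_norm N \<beta> \<alpha> \<alpha>h n nh = fact r * pochhammer A n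
       * pochhammer (\<alpha>h + \<beta> + real (n + nh)) nh / pochhammer (\<beta> + 1) (n + nh - 1)"
    by (simp add: hahn_typeI_norm_def r_def A_def)
  have "hahn_typeI_coeff N \<beta> \<alpha> \<alpha>h n nh l = hahn_typeI_const N \<beta> \<alpha> \<alpha>h n nh *
      (pochhammer A l * pochhammer D l / (fact l * pochhammer (\<alpha> + 1) l * pochhammer (- real N) l))
     * (pochhammer (- real n + 1) l * pochhammer (- real N) l / (pochhammer (- real n - real nh + 2) l * pochhammer E0 l) * W)"
    unfolding hahn_typeI_coeff_def T[symmetric] using assms by (simp add: A_def D_def E0_def)
  also have "\<dots> = (-1) ^ l * (-1) ^ p * (fact r * fact (h + p) / (fact h * fact l * fact p))
      * pochhammer E p * pochhammer (\<alpha>h + \<beta> + real (n + nh)) nh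
      / (pochhammer (\<beta> + 1) (n + nh - 1) * pochhammer C nh * pochhammer e p * pochhammer (\<alpha> + 1) l) * W
      * (pochhammer A l / pochhammer (A + real n) r)"
    unfolding K f6 f7 using Dnz f4 pos(4)[of l] by (simp add: mult_ac)
  also have "\<dots> = hahn_typeI_norm N \<beta> \<alpha> \<alpha>h n nh * (-1) ^ l / pochhammer (\<alpha> + 1) l
     * ((-1) ^ p / (fact l * fact p * pochhammer B q) / pochhammer C nh
        * (pochhammer (real nh) p * pochhammer E p * W / (pochhammer e p * pochhammer d p)))"
    unfolding f2'[symmetric] f5 norm by (simp add: mult_ac)
  finally show ?thesis unfolding p_def[symmetric] S .
qed

text \<open>Chu-Vandermonde expands (\<alpha>+1+x)_i / (\<alpha>+1)_i in the basis (-x)_l. After the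
  exchange of sums, the coefficient of (-x)_l is the residue sum already identified with the
  explicit one.\<close>

lemma hahn_typeI_eq_residues:
  assumes "\<alpha> > -1" "\<alpha>h > -1" "\<beta> > -1" "2 \<le> n + nh" "n + nh \<le> N + 1"
    and distinct: "\<And>i j. i < n \<Longrightarrow> j < nh \<Longrightarrow> \<alpha> + real i \<noteq> \<alpha>h + real j"
  shows "hahn_typeI N \<beta> \<alpha> \<alpha>h n nh x = hahn_typeI_norm N \<beta> \<alpha> \<alpha>h n nh
    * (\<Sum>i<n. hahn_residue N \<beta> \<alpha> \<alpha>h n nh i * (pochhammer (\<alpha> + 1 + x) i / pochhammer (\<alpha> + 1) i))"
proof (cases n)
  case 0
  then show ?thesis by (simp add: hahn_typeI_def)
next
  case (Suc t)
  let ?R = "hahn_residue N \<beta> \<alpha> \<alpha>h n nh" and ?c = "hahn_typeI_norm N \<beta> \<alpha> \<alpha>h n nh"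
  let ?g = "\<lambda>l. (-1) ^ l / pochhammer (\<alpha> + 1) l * pochhammer (- x) l"
  have pos: "pochhammer (\<alpha> + 1 + real i) j > 0" for i j
    using assms(1) by (intro pochhammer_pos) simp
  have coeff: "hahn_typeI_coeff N \<beta> \<alpha> \<alpha>h n nh l = ?c * (-1) ^ l / pochhammer (\<alpha> + 1) l
    * (\<Sum>u\<le>t - l. ?R (l + u) * real ((l + u) choose l))" if "l \<le> t" for l
  proof (cases "nh = 0")
    case True
    then show ?thesis
      using hahn_typeI_coeff_eq_residues_0[of \<alpha> \<beta> l n N \<alpha>h] assms that Suc by simp
  next
    case False
    then show ?thesis
      using hahn_typeI_coeff_eq_residues_pos[of \<alpha> \<alpha>h \<beta> l n nh N] assms that Suc by simp
  qed
  have expand: "pochhammer (\<alpha> + 1 + x) i / pochhammer (\<alpha> + 1) i = (\<Sum>l\<le>i. real (i choose l) * ?g l)" for i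
  proof -
    have "pochhammer (\<alpha> + 1 + x) i / pochhammer (\<alpha> + 1) i = (\<Sum>l\<le>i. (-1) ^ l * real (i choose l)
        * pochhammer (- x) l * pochhammer (\<alpha> + 1 + real l) (i - l) / pochhammer (\<alpha> + 1) i)"
      using chu_vandermonde[of i "- x" "\<alpha> + 1"] by (simp flip: sum_divide_distrib)
    also have "\<dots> = (\<Sum>l\<le>i. real (i choose l) * ?g l)"
    proof (rule sum.cong[OF refl])
      fix l assume "l \<in> {..i}"
      then have "pochhammer (\<alpha> + 1) i = pochhammer (\<alpha> + 1) l * pochhammer (\<alpha> + 1 + real l) (i - l)"
        by (simp add: pochhammer_product)
      then show "(-1) ^ l * real (i choose l) * pochhammer (- x) l * pochhammer (\<alpha> + 1 + real l) (i - l)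
          / pochhammer (\<alpha> + 1) i = real (i choose l) * ?g l"
        using pos[of l "i - l"] by simp
    qed
    finally show ?thesis .
  qed
  have "hahn_typeI N \<beta> \<alpha> \<alpha>h n nh x = (\<Sum>l\<le>t. hahn_typeI_coeff N \<beta> \<alpha> \<alpha>h n nh l * pochhammer (- x) l)"
    by (simp add: hahn_typeI_def Suc lessThan_Suc_atMost)
  also have "\<dots> = (\<Sum>l\<le>t. ?c * (\<Sum>u\<le>t - l. ?R (l + u) * (real ((l + u) choose l) * ?g l)))"
  proof (rule sum.cong[OF refl])
    fix l assume "l \<in> {..t}"
    then have "hahn_typeI_coeff N \<beta> \<alpha> \<alpha>h n nh l * pochhammer (- x) l
        = ?c * (?g l * (\<Sum>u\<le>t - l. ?R (l + u) * real ((l + u) choose l)))"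
      by (simp add: coeff)
    also have "?g l * (\<Sum>u\<le>t - l. ?R (l + u) * real ((l + u) choose l))
        = (\<Sum>u\<le>t - l. ?R (l + u) * (real ((l + u) choose l) * ?g l))"
      unfolding sum_distrib_left by (intro sum.cong refl) (simp only: mult_ac)
    finally show "hahn_typeI_coeff N \<beta> \<alpha> \<alpha>h n nh l * pochhammer (- x) l
        = ?c * (\<Sum>u\<le>t - l. ?R (l + u) * (real ((l + u) choose l) * ?g l))" .
  qed
  also have "\<dots> = ?c * (\<Sum>i\<le>t. \<Sum>l\<le>i. ?R i * (real (i choose l) * ?g l))"
    unfolding sum_swap_triangle by (rule sum_distrib_left[symmetric])
  also have "\<dots> = ?c * (\<Sum>i<n. ?R i * (pochhammer (\<alpha> + 1 + x) i / pochhammer (\<alpha> + 1) i))"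
    unfolding expand sum_distrib_left by (simp add: Suc lessThan_Suc_atMost)
  finally show ?thesis .
qed

section \<open>Moments of the type I linear form\<close>

text \<open>Each quotient (\<alpha>+1+k)_i / (\<alpha>+1)_i moves the kernel parameter to \<alpha> +
  i. The moment is thus a combination of kernel moments, the values at the nodes of one polynomial
  in \<open>z\<close>.\<close>

lemma hahn_typeI_kernel_moment:
  assumes "\<alpha> > -1" "\<alpha>h > -1" "\<beta> > -1" "2 \<le> n + nh" "n + nh \<le> N + 1" "j \<le> N"
    and distinct: "\<And>i j. i < n \<Longrightarrow> j < nh \<Longrightarrow> \<alpha> + real i \<noteq> \<alpha>h + real j"
  shows "(\<Sum>k\<le>N. hahn_typeI N \<beta> \<alpha> \<alpha>h n nh (real k) * hahn_kernel N \<beta> \<alpha> k * pochhammer (- real k) j)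
    = hahn_typeI_norm N \<beta> \<alpha> \<alpha>h n nh * ((-1) ^ j / fact (N - j)) * (\<Sum>i<n. hahn_residue N \<beta> \<alpha> \<alpha>h n nh i
      * (pochhammer (\<alpha> + real i + 1) j * pochhammer (\<alpha> + real i + \<beta> + 2 + real j) (N - j)))"
proof -
  let ?R = "hahn_residue N \<beta> \<alpha> \<alpha>h n nh" and ?c = "hahn_typeI_norm N \<beta> \<alpha> \<alpha>h n nh"
  have pos: "pochhammer (\<alpha> + 1) i > 0" for i
    using assms(1) by (intro pochhammer_pos) simp
  have eq: "hahn_typeI N \<beta> \<alpha> \<alpha>h n nh x
      = ?c * (\<Sum>i<n. ?R i * (pochhammer (\<alpha> + 1 + x) i / pochhammer (\<alpha> + 1) i))" for x
    using assms by (intro hahn_typeI_eq_residues)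
  have "hahn_typeI N \<beta> \<alpha> \<alpha>h n nh (real k) * hahn_kernel N \<beta> \<alpha> k * pochhammer (- real k) j
      = (\<Sum>i<n. ?c * ?R i * (pochhammer (- real k) j * hahn_kernel N \<beta> (\<alpha> + real i) k))" for k
    unfolding eq sum_distrib_left sum_distrib_right
    by (intro sum.cong refl) (simp add: hahn_kernel_shift less_imp_neq[OF pos, symmetric])
  then have "(\<Sum>k\<le>N. hahn_typeI N \<beta> \<alpha> \<alpha>h n nh (real k) * hahn_kernel N \<beta> \<alpha> k * pochhammer (- real k) j)
      = (\<Sum>i<n. ?c * ?R i * (\<Sum>k\<le>N. pochhammer (- real k) j * hahn_kernel N \<beta> (\<alpha> + real i) k))"
    by (simp only: sum_distrib_left) (rule sum.swap)
  also have "\<dots> = (\<Sum>i<n. ?c * ((-1) ^ j / fact (N - j)) * (?R i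
      * (pochhammer (\<alpha> + real i + 1) j * pochhammer (\<alpha> + real i + \<beta> + 2 + real j) (N - j))))"
    unfolding hahn_kernel_moment[OF assms(6)] by (intro sum.cong refl) simp
  finally show ?thesis by (simp only: sum_distrib_left)
qed

text \<open>
  For \<open>n + nh = 1\<close> the residue representation can be \<open>0 / 0\<close>, because \<open>\<alpha> + \<beta> + 1\<close> may vanish.
\<close>
lemma hahn_typeI_1_0:
  assumes "\<alpha> > -1" "\<beta> > -1"
  shows "(\<Sum>k\<le>N. hahn_typeI N \<beta> \<alpha> \<alpha>h 1 0 (real k) * hahn_kernel N \<beta> \<alpha> k) = 1"
proof -
  have "pochhammer (\<alpha> + \<beta> + 2) N > 0" using assms by (intro pochhammer_pos) simp
  moreover have "(\<Sum>k\<le>N. hahn_kernel N \<beta> \<alpha> k) = pochhammer (\<alpha> + \<beta> + 2) N / fact N"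
    using hahn_kernel_moment[of 0 N \<beta> \<alpha>] by simp
  ultimately show ?thesis
    by (simp add: hahn_typeI_def hahn_typeI_coeff_def flip: sum_divide_distrib sum_distrib_left)
qed

text \<open>Both components share one normalization, so their node sums add up to the full residue
  sum. At j = n1 + n2 - 1 its value is the reciprocal of the normalization, apart from
  \<open>fact (N - j)\<close>.\<close>

lemma hahn_typeI_moments:
  assumes "\<alpha>1 > -1" "\<alpha>2 > -1" "\<beta> > -1" "n1 + n2 \<le> N + 1" "j < n1 + n2"
    and distinct: "\<And>i j. i < n1 \<Longrightarrow> j < n2 \<Longrightarrow> \<alpha>1 + real i \<noteq> \<alpha>2 + real j"
  shows "(\<Sum>k\<le>N. (hahn_typeI N \<beta> \<alpha>1 \<alpha>2 n1 n2 (real k) * hahn_kernel N \<beta> \<alpha>1 k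
      + hahn_typeI N \<beta> \<alpha>2 \<alpha>1 n2 n1 (real k) * hahn_kernel N \<beta> \<alpha>2 k) * pochhammer (- real k) j)
    = (if j = n1 + n2 - 1 then (-1) ^ j else 0)"
proof (cases "2 \<le> n1 + n2")
  case False
  then have "j = 0" "n1 = 1 \<and> n2 = 0 \<or> n1 = 0 \<and> n2 = 1" using assms by auto
  moreover have "hahn_typeI N \<beta> a b 0 n x = 0" for a b n x by (simp add: hahn_typeI_def)
  ultimately show ?thesis
    using hahn_typeI_1_0[OF assms(1,3), of N \<alpha>2] hahn_typeI_1_0[OF assms(2,3), of N \<alpha>1] by auto
next
  case True
  let ?c = "hahn_typeI_norm N \<beta> \<alpha>1 \<alpha>2 n1 n2"
  have j: "j \<le> N" using assms by simp
  have "\<alpha>2 + real i \<noteq> \<alpha>1 + real j" if "i < n2" "j < n1" for i j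
    using distinct[OF that(2,1)] by simp
  then have "(\<Sum>k\<le>N. (hahn_typeI N \<beta> \<alpha>1 \<alpha>2 n1 n2 (real k) * hahn_kernel N \<beta> \<alpha>1 k
      + hahn_typeI N \<beta> \<alpha>2 \<alpha>1 n2 n1 (real k) * hahn_kernel N \<beta> \<alpha>2 k) * pochhammer (- real k) j)
     = ?c * ((-1) ^ j / fact (N - j)) * ((\<Sum>i<n1. hahn_residue N \<beta> \<alpha>1 \<alpha>2 n1 n2 i
      * (pochhammer (\<alpha>1 + real i + 1) j * pochhammer (\<alpha>1 + real i + \<beta> + 2 + real j) (N - j)))
      + (\<Sum>i<n2. hahn_residue N \<beta> \<alpha>2 \<alpha>1 n2 n1 i
      * (pochhammer (\<alpha>2 + real i + 1) j * pochhammer (\<alpha>2 + real i + \<beta> + 2 + real j) (N - j))))"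
    using hahn_typeI_kernel_moment[of \<alpha>1 \<alpha>2 \<beta> n1 n2 N j] hahn_typeI_kernel_moment[of \<alpha>2 \<alpha>1 \<beta> n2 n1 N j]
      assms True j hahn_typeI_norm_commute[of N \<beta> \<alpha>2 \<alpha>1 n2 n1]
    by (simp add: distrib_right distrib_left sum.distrib add.commute[of n2 n1])
  also have "\<dots> = (if j = n1 + n2 - 1 then (-1) ^ j else 0)"
  proof -
    have "pochhammer (a + \<beta> + real (n1 + n2)) i > 0" if "a > -1" for a i
      using that assms True by (intro pochhammer_pos) simp
    note pos = this[OF assms(1)] this[OF assms(2)]
    have "pochhammer (\<beta> + 1) i > 0" for i
      using assms by (intro pochhammer_pos) simp
    note pos = pos this
    have N: "N + 1 - n1 - n2 = N - (n1 + n2 - 1)" using True assms(4) by simp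
    let ?p1 = "pochhammer (\<alpha>1 + \<beta> + real (n1 + n2)) n1" and ?p2 = "pochhammer (\<alpha>2 + \<beta> + real (n1 + n2)) n2"
      and ?b = "pochhammer (\<beta> + 1) (n1 + n2 - 1)"
    have "(\<Sum>i<n1. hahn_residue N \<beta> \<alpha>1 \<alpha>2 n1 n2 i
      * (pochhammer (\<alpha>1 + real i + 1) j * pochhammer (\<alpha>1 + real i + \<beta> + 2 + real j) (N - j)))
      + (\<Sum>i<n2. hahn_residue N \<beta> \<alpha>2 \<alpha>1 n2 n1 i
      * (pochhammer (\<alpha>2 + real i + 1) j * pochhammer (\<alpha>2 + real i + \<beta> + 2 + real j) (N - j)))
      = (if j = n1 + n2 - 1 then ?b / (?p1 * ?p2) else 0)"
      using assms True by (intro sum_hahn_residues)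
    moreover have "?p1 > 0" "?p2 > 0" "?b > 0" using pos by blast+
    ultimately show ?thesis
      unfolding hahn_typeI_norm_def N by (auto simp: divide_simps)
  qed
  finally show ?thesis .
qed

section \<open>Biorthogonality\<close>

theorem theorem2p4:
  fixes N n1 n2 m1 m2 :: nat and \<alpha>1 \<alpha>2 \<beta> :: real
  assumes "\<alpha>1 > -1" and "\<alpha>2 > -1" and "\<beta> > -1"
    and "AT_system N (hahn_weight N \<alpha>1 \<beta>) (hahn_weight N \<alpha>2 \<beta>)"
    and "n1 + n2 \<le> N + 1"
  shows "let S = (\<Sum>k = 0..N.
           (hahn_typeI N \<beta> \<alpha>1 \<alpha>2 n1 n2 (real k) * hahn_weight N \<alpha>1 \<beta> (real k) +
            hahn_typeI N \<beta> \<alpha>2 \<alpha>1 n2 n1 (real k) * hahn_weight N \<alpha>2 \<beta> (real k)) *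
           hahn_typeII N \<beta> \<alpha>1 \<alpha>2 m1 m2 (real k))
         in (n1 \<le> m1 \<and> n2 \<le> m2 \<longrightarrow> S = 0) \<and>
            (int m1 + int m2 = int n1 + int n2 - 1 \<longrightarrow> S = 1) \<and>
            (int m1 + int m2 \<le> int n1 + int n2 - 2 \<longrightarrow> S = 0)"
proof -
  define L where "L k = hahn_typeI N \<beta> \<alpha>1 \<alpha>2 n1 n2 (real k) * hahn_kernel N \<beta> \<alpha>1 k
      + hahn_typeI N \<beta> \<alpha>2 \<alpha>1 n2 n1 (real k) * hahn_kernel N \<beta> \<alpha>2 k" for k
  define Q where "Q k = hahn_typeII N \<beta> \<alpha>1 \<alpha>2 m1 m2 (real k)" for k
  let ?q = "hahn_typeII_coeff N \<beta> \<alpha>1 \<alpha>2 m1 m2"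
  have S: "(\<Sum>k = 0..N.
           (hahn_typeI N \<beta> \<alpha>1 \<alpha>2 n1 n2 (real k) * hahn_weight N \<alpha>1 \<beta> (real k) +
            hahn_typeI N \<beta> \<alpha>2 \<alpha>1 n2 n1 (real k) * hahn_weight N \<alpha>2 \<beta> (real k)) *
           hahn_typeII N \<beta> \<alpha>1 \<alpha>2 m1 m2 (real k)) = (\<Sum>k\<le>N. L k * Q k)"
    using assms unfolding atLeast0AtMost L_def Q_def
    by (intro sum.cong refl) (simp add: hahn_weight_eq_kernel)
  \<comment> \<open>The type I components are expanded in (-k)_l with l < n1 \<le> m1 and l < n2
    \<le> m2 respectively, and type II orthogonality removes every term.\<close>
  have upper: "(\<Sum>k\<le>N. L k * Q k) = 0" if "n1 \<le> m1" "n2 \<le> m2"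
  proof -
    have 0: "(\<Sum>k\<le>N. hahn_typeI N \<beta> a b n n' (real k) * hahn_kernel N \<beta> a k * Q k) = 0"
      if "\<And>l. l < n \<Longrightarrow> (\<Sum>k\<le>N. Q k * hahn_kernel N \<beta> a k * pochhammer (- real k) l) = 0" for a b n n'
    proof -
      have "hahn_typeI N \<beta> a b n n' (real k) * hahn_kernel N \<beta> a k * Q k = (\<Sum>l<n. hahn_typeI_coeff N \<beta> a b n n' l
          * (Q k * hahn_kernel N \<beta> a k * pochhammer (- real k) l))" for k
        unfolding hahn_typeI_def sum_distrib_right by (intro sum.cong refl) (simp only: mult_ac)
      then have "(\<Sum>k\<le>N. hahn_typeI N \<beta> a b n n' (real k) * hahn_kernel N \<beta> a k * Q k)
          = (\<Sum>l<n. hahn_typeI_coeff N \<beta> a b n n' l * (\<Sum>k\<le>N. Q k * hahn_kernel N \<beta> a k * pochhammer (- real k) l))"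
        by (simp only: sum_distrib_left) (rule sum.swap)
      with that show ?thesis by simp
    qed
    have "(\<Sum>k\<le>N. hahn_typeI N \<beta> \<alpha>1 \<alpha>2 n1 n2 (real k) * hahn_kernel N \<beta> \<alpha>1 k * Q k) = 0"
      unfolding Q_def using that hahn_typeII_orthogonal(1)[OF assms(1,2)] by (intro 0[unfolded Q_def]) simp
    moreover have "(\<Sum>k\<le>N. hahn_typeI N \<beta> \<alpha>2 \<alpha>1 n2 n1 (real k) * hahn_kernel N \<beta> \<alpha>2 k * Q k) = 0"
      unfolding Q_def using that hahn_typeII_orthogonal(2)[OF assms(1,2)] by (intro 0[unfolded Q_def]) simp
    ultimately show ?thesis
      by (simp add: L_def distrib_right sum.distrib)
  qed
  \<comment> \<open>Dually, the type II polynomial is expanded in (-k)_l. Moments of order below n1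
    + n2 - 1 vanish, so at most l = m1 + m2 survives, and then its coefficient and the moment are
    both (-1)^(m1+m2).\<close>
  have lower: "(\<Sum>k\<le>N. L k * Q k) = (if m1 + m2 + 1 = n1 + n2 then 1 else 0)" if "m1 + m2 < n1 + n2"
  proof -
    have moments: "(\<Sum>k\<le>N. L k * pochhammer (- real k) l) = (if l + 1 = n1 + n2 then (-1) ^ l else 0)"
      if "l < n1 + n2" for l
    proof -
      have "(\<Sum>k\<le>N. L k * pochhammer (- real k) l) = (if l = n1 + n2 - 1 then (-1) ^ l else 0)"
        unfolding L_def using assms that
        by (intro hahn_typeI_moments) (auto dest: AT_system_hahn_nodes[OF assms(4,1-3,5)])
      then show ?thesis using that by auto
    qed
    have "L k * Q k = (\<Sum>l\<le>m1 + m2. ?q l * (L k * pochhammer (- real k) l))" for k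
      unfolding Q_def hahn_typeII_eq_sum sum_distrib_left by (intro sum.cong refl) (simp only: mult_ac)
    then have "(\<Sum>k\<le>N. L k * Q k) = (\<Sum>l\<le>m1 + m2. ?q l * (\<Sum>k\<le>N. L k * pochhammer (- real k) l))"
      by (simp only: sum_distrib_left) (rule sum.swap)
    also have "\<dots> = (\<Sum>l\<le>m1 + m2. if l = m1 + m2
        then (if m1 + m2 + 1 = n1 + n2 then ?q (m1 + m2) * (-1) ^ (m1 + m2) else 0) else 0)"
      using that by (intro sum.cong refl) (auto simp: moments)
    also have "\<dots> = (if m1 + m2 + 1 = n1 + n2 then 1 else 0)"
      using hahn_typeII_coeff_lead[OF assms(1-3)] by (simp flip: power_mult_distrib)
    finally show ?thesis .
  qed
  \<comment> \<open>With subtraction in the integers the last two cases force m1 + m2 < n1 + n2, so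
    they are void for n1 = n2 = 0.\<close>
  show ?thesis
    unfolding Let_def S using upper lower by auto
qed

end
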